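(* Let $\mathbf M_1^{\mathcal T},\mathbf M_2^{\mathcal T}$ be total topological structures on a common set $M$ with a common compact Hausdorff topology, and let $\mathbf N_1^{\mathcal T},\mathbf N_2^{\mathcal T}$ be total topological structures on a common set $N$ with a common compact Hausdorff topology; $\mathbf M_i,\mathbf N_i$ denote the structures without topology. Assume that $\mathbf M_2^{\mathcal T}$ and $\mathbf N_2^{\mathcal T}$ are alter egos of $\mathbf M_1$ and $\mathbf N_1$, respectively. For $i\in\{1,2\}$ put $\mathcal A_i=\mathbb{ISP}(\mathbf M_i)$, $\mathcal B_i=\mathbb{ISP}(\mathbf N_i)$, $\mathcal X_i=\mathbb{IS}_c\mathbb P^+(\mathbf M_i^{\mathcal T})$, $\mathcal Y_i=\mathbb{IS}_c\mathbb P^+(\mathbf N_i^{\mathcal T})$. Assume that $\mathbf N_1^{\mathcal T}$ fully dualises $\mathbf N_2$ with $\mathbf N_1^{\mathcal T}$ injective in $\mathcal Y_1$ and $\mathbf N_2$ injective in $\mathcal B_2$, and that $\mathbf N_2^{\mathcal T}$ fully dualises $\mathbf N_1$ with $\mathbf N_2^{\mathcal T}$ injective in $\mathcal Y_2$ and $\mathbf N_1$ injective in $\mathcal B_1$. Assume that $\mathbf M_1$ and $\mathbf M_2$ have structural reducts $\mathbf M_1^\flat$ and $\mathbf M_2^\flat$ with $(\mathbf M_1^\flat)^{\mathcal T}\in\mathcal Y_1$ and $(\mathbf M_2^\flat)^{\mathcal T}\in\mathcal Y_2$. Let $\omega$ be a continuous map in $\mathcal B_1(\mathbf M_1^\flat,\mathbf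 N_1)\cap\mathcal B_2(\mathbf M_2^\flat,\mathbf N_2)$. Assume that one of the following sets of conditions (I), (II) holds. (I) (1) $\mathbf N_1$ is a total algebra and $\mathbf N_2=\langle N;G^\nu,R^\nu\rangle$; and (2) (i) $\omega\circ\mathrm{Clo}_1(\mathbf M_2)$ separates the points of $M$, (ii) $\omega\circ\mathrm{Clo}_1(\mathbf M_1)$ separates the structure $\mathbf M_2^\flat$, and (iii) both $\mathbf M_2$ and $\mathbf M_2^{\mathcal T}$ entail every relation in $\max_{\mathbf M_1}\{\omega\}^{-1}(r)$, for each $r\in R^\nu$. (II) (1) Both $\mathbf N_1$ and $\mathbf N_2$ are total algebras; and (2) (i) $\omega\circ\mathrm{Clo}_1(\mathbf M_2)$ separates the points of $M$, and (ii) $\omega\circ\mathrm{Clo}_1(\mathbf M_1)$ separates the points of $M$. Then: (a) $\mathbf M_2^{\mathcal T}$ fully dualises $\mathbf M_1$, with $\mathbf M_1$ injective in $\mathcal A_1$ and $\mathbf M_2^{\mathcal T}$ injective in $\mathcal X_2$; (b) $\mathbf M_1^{\mathcal T}$ fully dualises $\mathbf M_2$, with $\mathbf M_2$ injective in $\mathcal A_2$ and $\mathbf M_1^{\mathcal T}$ injective in $\mathcal X_1$; (c) for $(i,j)\in\{(1,2),(2,1)\}$, all $\mathbf A\in\mathcal A_i$ and all $\mathbf X\in\mathcal X_j$, the map $x\mapsto\omega\circ x$ is an isomorphism $\mathcal A_i(\mathbf A,\mathbf M_i)^\flat\cong\mathcal B_i(\mathbf A^\flat,\mathbf N_i)$ in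 $\mathcal Y_j$, and the map $\alpha\mapsto\omega\circ\alpha$ is an isomorphism $\mathcal X_j(\mathbf X,\mathbf M_j^{\mathcal T})^\flat\cong\mathcal Y_j(\mathbf X^\flat,\mathbf N_j^{\mathcal T})$ in $\mathcal B_i$.
   Context: **Structures.** A total structure is $\mathbf M=\langle M;G,R\rangle$ with $M$ a non-empty set, $G$ a set of finitary operations (nullary allowed) and $R$ a set of finitary non-empty relations on $M$; $G$ or $R$ may be empty. It is a total algebra if $R=\varnothing$. Operations and relations are lifted pointwise to powers. A substructure ($\le$) is a subset closed under the operations, with the restricted relations; substructures of structures without topology are non-empty. Homomorphisms preserve all operations and relations. For a compact Hausdorff topology $\mathcal T$ on $M$, $\mathbf M^{\mathcal T}=\langle M;G,R,\mathcal T\rangle$ is a topological structure if all operations in $G$ are continuous and all relations in $R$ are topologically closed. The symbol $\mathcal T$ is used for both the topology on $M$ and that on $N$. **Classes.** $\mathbb{ISP}(\mathbf M)$ is the category of all (non-empty) structures isomorphic to substructures of powers of $\mathbf M$, with homomorphisms as morphisms. $\mathbb{IS}_c\mathbb P^+(\mathbf M^{\mathcal T})$ is the category of all structures with topology isomorphic to topologically closed substructures of powers $(\mathbf M^{\mathcal T})^S$ with $S\neq\varnothing$ (product topology), with continuous homomorphisms as morphisms; the empty structure belongs to it if the type has no nullary operations. $\mathcal C(\mathbf A,\mathbf B)$ denotes the set of morphisms in a category $\mathcal C$. Embeddings are isomorphisms onto substructures in $\mathbb{ISP}(\mathbf M)$ and isomorphisms onto topologically closed substructures in $\mathbb{IS}_c\mathbb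 P^+(\mathbf M^{\mathcal T})$; injectivity is with respect to these embeddings. **Alter egos.** $\mathbf Q^{\mathcal T}=\langle M;G_2,R_2,\mathcal T\rangle$ is an alter ego of $\mathbf P=\langle M;G_1,R_1\rangle$ if each $n$-ary $r\in R_2$ forms a substructure of $\mathbf P^n$, each $n$-ary $g\in G_2$ is a homomorphism $\mathbf P^n\to\mathbf P$, each relation in $R_1$ is topologically closed and each operation in $G_1$ is continuous with respect to $\mathcal T$. When $\mathbf P^{\mathcal T}$ and $\mathbf Q^{\mathcal T}$ are both topological structures, $\mathbf Q^{\mathcal T}$ is an alter ego of $\mathbf P$ if and only if $\mathbf P^{\mathcal T}$ is an alter ego of $\mathbf Q$. **Dualities.** Let $\mathbf Q^{\mathcal T}$ be an alter ego of $\mathbf P$, $\mathcal A=\mathbb{ISP}(\mathbf P)$, $\mathcal X=\mathbb{IS}_c\mathbb P^+(\mathbf Q^{\mathcal T})$. For $\mathbf A\in\mathcal A$, $\mathcal A(\mathbf A,\mathbf P)$ is a closed substructure of $(\mathbf Q^{\mathcal T})^A$, giving $\mathrm D(\mathbf A)\in\mathcal X$; for $\mathbf X\in\mathcal X$, $\mathcal X(\mathbf X,\mathbf Q^{\mathcal T})$ is a substructure of $\mathbf P^X$, giving $\mathrm E(\mathbf X)\in\mathcal A$. The evaluation maps are $e_{\mathbf A}\colon\mathbf A\to\mathrm{ED}(\mathbf A)$, $e_{\mathbf A}(a)(x)=x(a)$, and $\varepsilon_{\mathbf X}\colon\mathbf X\to\mathrm{DE}(\mathbf X)$, $\varepsilon_{\mathbf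 X}(x)(\alpha)=\alpha(x)$. $\mathbf Q^{\mathcal T}$ fully dualises $\mathbf P$ if $e_{\mathbf A}$ and $\varepsilon_{\mathbf X}$ are isomorphisms for all $\mathbf A\in\mathcal A$ and all $\mathbf X\in\mathcal X$. **Term functions and separation.** $\mathrm{Clo}_1(\cdot)$ is the set of unary term functions; $\omega\circ\mathcal E=\{\omega\circ u\mid u\in\mathcal E\}$. A set $Z$ of maps from $A$ to $N$ separates the points of $A$ if for all $a\ne b$ in $A$ some $z\in Z$ has $z(a)\neq z(b)$; it separates the structure $\mathbf A$ (where $\mathbf A$ and $\mathbf N_i$ have the same type) if it separates the points and, for every $n$-ary relation symbol $r$ of the type and $(a_1,\dots,a_n)\notin r^{\mathbf A}$, some $z\in Z$ has $(z(a_1),\dots,z(a_n))\notin r^{\mathbf N_i}$. (For $\mathbf M_2^\flat$, $i=2$.) **Structural reducts.** $\langle M;G',R'\rangle$ is a structural reduct of $\langle M;G,R\rangle$ if each operation in $G'$ is a term function of $\langle M;G,R\rangle$ (a nullary term function if nullary) and each relation in $R'$ is conjunct-atomic definable, i.e. is the set of tuples satisfying a finite conjunction of atomic formulas in the language $\langle G,R\rangle$ (with equality). Here $\mathbf M_i^\flat$ has the type of $\mathbf N_i$, and every $\mathbf A\in\mathcal A_i$ (respectively $\mathbf X\in\mathcal X_i$) has a reduct $\mathbf A^\flat\in\mathcal B_i$ (respectively $\mathbf X^\flat\in\mathcal Y_i$) given by the same terms and formulas. **Maximal relations and entailment.** For $r\subseteq N^n$, $\max_{\mathbf M_1}\{\omega\}^{-1}(r)$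 is the set of all $s\subseteq M^n$ forming a substructure of $\mathbf M_1^n$ that is maximal (among substructures) in $\{(a_1,\dots,a_n)\in M^n\mid(\omega(a_1),\dots,\omega(a_n))\in r\}$. $\mathbf M_2^{\mathcal T}$ entails $s\subseteq M^n$ if $s$ forms a substructure of $\mathbf M_1^n$ and, for all $\mathbf A\in\mathcal A_1$, every $\mathcal X_2$-morphism $\alpha\colon\mathcal A_1(\mathbf A,\mathbf M_1)\to\mathbf M_2^{\mathcal T}$ preserves $s$ (lifted pointwise). $\mathbf M_2$ entails $s\subseteq M^n$ if $s$ forms a topologically closed substructure of $(\mathbf M_1^{\mathcal T})^n$ and, for all $\mathbf X\in\mathcal X_1$, every $\mathcal A_2$-morphism $u\colon\mathcal X_1(\mathbf X,\mathbf M_1^{\mathcal T})\to\mathbf M_2$ preserves $s$ (lifted pointwise). *)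

theory Defs
  imports "HOL-Analysis.Analysis"
begin

section \<open>Structures\<close>

text \<open>
  An \<open>n\<close>-tuple over \<open>A\<close> is an extensional function on \<open>{..<n}\<close>. Hence the \<open>n\<close>-th power of a structure
  or of a topological space is literally its power over the index set \<open>{..<n}\<close>, and
  \<^term>\<open>compose {..<n} f a\<close> is the tuple \<open>(f a\<^sub>1, \<dots>, f a\<^sub>n)\<close>.
\<close>

abbreviation tuples :: "nat \<Rightarrow> 'a set \<Rightarrow> (nat \<Rightarrow> 'a) set" where
  "tuples n A \<equiv> {..<n} \<rightarrow>\<^sub>E A"

abbreviation tpower :: "'i set \<Rightarrow> 'a topology \<Rightarrow> ('i \<Rightarrow> 'a) topology" where
  "tpower S T \<equiv> product_topology (\<lambda>_. T) S"

text \<open>Operations and relations are indexed by symbols, so that structures can be of the same type.\<close>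

record ('f, 'r) signature =
  opsyms :: "'f set"
  relsyms :: "'r set"
  oparity :: "'f \<Rightarrow> nat"
  relarity :: "'r \<Rightarrow> nat"

record ('a, 'f, 'r) struct =
  sg :: "('f, 'r) signature"
  carr :: "'a set"
  opn :: "'f \<Rightarrow> (nat \<Rightarrow> 'a) \<Rightarrow> 'a"
  rln :: "'r \<Rightarrow> (nat \<Rightarrow> 'a) set"

type_synonym ('a, 'f, 'r) tstruct = "('a, 'f, 'r) struct \<times> 'a topology"

abbreviation oar :: "('a, 'f, 'r) struct \<Rightarrow> 'f \<Rightarrow> nat" where
  "oar A \<equiv> oparity (sg A)"

abbreviation rar :: "('a, 'f, 'r) struct \<Rightarrow> 'r \<Rightarrow> nat" where
  "rar A \<equiv> relarity (sg A)"

text \<open>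
  The carrier and the relations may be empty here: this happens for substructures of powers,
  but not for the total structures generating the classes.
\<close>

definition is_struct :: "('a, 'f, 'r) struct \<Rightarrow> bool" where
  "is_struct A \<longleftrightarrow>
     (\<forall>g\<in>opsyms (sg A). \<forall>a\<in>tuples (oar A g) (carr A). opn A g a \<in> carr A) \<and>
     (\<forall>r\<in>relsyms (sg A). rln A r \<subseteq> tuples (rar A r) (carr A))"

definition total_struct :: "('a, 'f, 'r) struct \<Rightarrow> bool" where
  "total_struct A \<longleftrightarrow> is_struct A \<and> carr A \<noteq> {} \<and> (\<forall>r\<in>relsyms (sg A). rln A r \<noteq> {})"

definition total_algebra :: "('a, 'f, 'r) struct \<Rightarrow> bool" where
  "total_algebra A \<longleftrightarrow> total_struct A \<and> relsyms (sg A) = {}"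

definition topological_struct :: "('a, 'f, 'r) struct \<Rightarrow> 'a topology \<Rightarrow> bool" where
  "topological_struct A T \<longleftrightarrow>
     total_struct A \<and> topspace T = carr A \<and> compact_space T \<and> Hausdorff_space T \<and>
     (\<forall>g\<in>opsyms (sg A). continuous_map (tpower {..<oar A g} T) T (opn A g)) \<and>
     (\<forall>r\<in>relsyms (sg A). closedin (tpower {..<rar A r} T) (rln A r))"

definition power_struct :: "('a, 'f, 'r) struct \<Rightarrow> 'i set \<Rightarrow> ('i \<Rightarrow> 'a, 'f, 'r) struct" where
  "power_struct P S =
     \<lparr>sg = sg P,
      carr = S \<rightarrow>\<^sub>E carr P,
      opn = (\<lambda>g a. \<lambda>s\<in>S. opn P g (\<lambda>i\<in>{..<oar P g}. a i s)),
      rln = (\<lambda>r. {a \<in> tuples (rar P r) (S \<rightarrow>\<^sub>E carr P). \<forall>s\<in>S. (\<lambda>i\<in>{..<rar P r}. a i s) \<in> rln P r})\<rparr>"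

definition subuniverse :: "'a set \<Rightarrow> ('a, 'f, 'r) struct \<Rightarrow> bool" where
  "subuniverse U A \<longleftrightarrow>
     U \<subseteq> carr A \<and> (\<forall>g\<in>opsyms (sg A). \<forall>a\<in>tuples (oar A g) U. opn A g a \<in> U)"

text \<open>Substructures are non-empty without topology, but may be empty with topology.\<close>

definition forms_substruct :: "'a set \<Rightarrow> ('a, 'f, 'r) struct \<Rightarrow> bool" where
  "forms_substruct U A \<longleftrightarrow> U \<noteq> {} \<and> subuniverse U A"

definition forms_closed_substruct :: "'a set \<Rightarrow> ('a, 'f, 'r) tstruct \<Rightarrow> bool" where
  "forms_closed_substruct U X \<longleftrightarrow> subuniverse U (fst X) \<and> closedin (snd X) U"

definition substruct :: "('a, 'f, 'r) struct \<Rightarrow> 'a set \<Rightarrow> ('a, 'f, 'r) struct" where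
  "substruct A U = A\<lparr>carr := U, rln := (\<lambda>r. rln A r \<inter> tuples (rar A r) U)\<rparr>"

definition tpower_struct :: "('a, 'f, 'r) tstruct \<Rightarrow> 'i set \<Rightarrow> ('i \<Rightarrow> 'a, 'f, 'r) tstruct" where
  "tpower_struct X S = (power_struct (fst X) S, tpower S (snd X))"

definition tsubstruct :: "('a, 'f, 'r) tstruct \<Rightarrow> 'a set \<Rightarrow> ('a, 'f, 'r) tstruct" where
  "tsubstruct X U = (substruct (fst X) U, subtopology (snd X) U)"


section \<open>Morphisms\<close>

definition homs :: "('a, 'f, 'r) struct \<Rightarrow> ('b, 'f, 'r) struct \<Rightarrow> ('a \<Rightarrow> 'b) set" where
  "homs A B = {f \<in> carr A \<rightarrow>\<^sub>E carr B. sg A = sg B \<and>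
     (\<forall>g\<in>opsyms (sg A). \<forall>a\<in>tuples (oar A g) (carr A).
        f (opn A g a) = opn B g (compose {..<oar A g} f a)) \<and>
     (\<forall>r\<in>relsyms (sg A). \<forall>a\<in>rln A r. compose {..<rar A r} f a \<in> rln B r)}"

definition chom :: "('a, 'f, 'r) tstruct \<Rightarrow> ('b, 'f, 'r) tstruct \<Rightarrow> ('a \<Rightarrow> 'b) set" where
  "chom X Y = {f \<in> homs (fst X) (fst Y). continuous_map (snd X) (snd Y) f}"

definition iso_struct :: "('a, 'f, 'r) struct \<Rightarrow> ('b, 'f, 'r) struct \<Rightarrow> ('a \<Rightarrow> 'b) \<Rightarrow> bool" where
  "iso_struct A B f \<longleftrightarrow>
     f \<in> homs A B \<and> bij_betw f (carr A) (carr B) \<and>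
     restrict (inv_into (carr A) f) (carr B) \<in> homs B A"

definition iso_tstruct :: "('a, 'f, 'r) tstruct \<Rightarrow> ('b, 'f, 'r) tstruct \<Rightarrow> ('a \<Rightarrow> 'b) \<Rightarrow> bool" where
  "iso_tstruct X Y f \<longleftrightarrow> iso_struct (fst X) (fst Y) f \<and> homeomorphic_map (snd X) (snd Y) f"

definition embedding :: "('a, 'f, 'r) struct \<Rightarrow> ('b, 'f, 'r) struct \<Rightarrow> ('a \<Rightarrow> 'b) \<Rightarrow> bool" where
  "embedding A B f \<longleftrightarrow> (\<exists>U. forms_substruct U B \<and> iso_struct A (substruct B U) f)"

definition tembedding :: "('a, 'f, 'r) tstruct \<Rightarrow> ('b, 'f, 'r) tstruct \<Rightarrow> ('a \<Rightarrow> 'b) \<Rightarrow> bool" where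
  "tembedding X Y f \<longleftrightarrow> (\<exists>U. forms_closed_substruct U Y \<and> iso_tstruct X (tsubstruct Y U) f)"


section \<open>The classes of structures\<close>

text \<open>
  Index sets of type \<^typ>\<open>('a \<Rightarrow> 'm) set\<close> suffice. Composing an embedding of \<open>A\<close> into a
  power with the projections gives maps from \<open>A\<close> to the carrier of \<open>P\<close>, and dropping repeated
  coordinates does not change the isomorphism type of the image (nor, by compactness, its topology
  and its being closed). The empty index set is admitted in \<open>ISP\<close> but not in \<open>IScPp\<close>.
\<close>

definition ISP :: "('m, 'f, 'r) struct \<Rightarrow> ('a, 'f, 'r) struct set" where
  "ISP P = {A. is_struct A \<and> (\<exists>(S :: ('a \<Rightarrow> 'm) set) e. embedding A (power_struct P S) e)}"

definition IScPp :: "('m, 'f, 'r) tstruct \<Rightarrow> ('x, 'f, 'r) tstruct set" where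
  "IScPp Q = {X. is_struct (fst X) \<and> topspace (snd X) = carr (fst X) \<and>
     (\<exists>(S :: ('x \<Rightarrow> 'm) set) e. S \<noteq> {} \<and> tembedding X (tpower_struct Q S) e)}"

text \<open>Isomorphisms in the categories \<open>ISP P\<close> and \<open>IScPp Q\<close>, which are full on their objects.\<close>

definition iso_in_ISP ::
    "('m, 'f, 'r) struct \<Rightarrow> ('a, 'f, 'r) struct \<Rightarrow> ('b, 'f, 'r) struct \<Rightarrow> ('a \<Rightarrow> 'b) \<Rightarrow> bool" where
  "iso_in_ISP P A B f \<longleftrightarrow> A \<in> ISP P \<and> B \<in> ISP P \<and> iso_struct A B f"

definition iso_in_IScPp ::
    "('m, 'f, 'r) tstruct \<Rightarrow> ('x, 'f, 'r) tstruct \<Rightarrow> ('y, 'f, 'r) tstruct \<Rightarrow> ('x \<Rightarrow> 'y) \<Rightarrow> bool" where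
  "iso_in_IScPp Q X Y f \<longleftrightarrow> X \<in> IScPp Q \<and> Y \<in> IScPp Q \<and> iso_tstruct X Y f"

text \<open>
  HOL cannot quantify over all sets at once. Notions that quantify over a whole class therefore
  carry a type argument \<^term>\<open>TYPE('u)\<close> and range over the members of the class with carrier in
  \<open>'u\<close>. Since \<open>'u\<close> can be instantiated with any type, this reaches every member of the class up to
  isomorphism.
\<close>

definition injective_ISP :: "'u itself \<Rightarrow> ('m, 'f, 'r) struct \<Rightarrow> bool" where
  "injective_ISP _ P \<longleftrightarrow>
     (\<forall>(A :: ('u, 'f, 'r) struct) \<in> ISP P. \<forall>(B :: ('u, 'f, 'r) struct) \<in> ISP P.
        \<forall>i f. embedding A B i \<and> f \<in> homs A P \<longrightarrow> (\<exists>g\<in>homs B P. compose (carr A) g i = f))"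

definition injective_IScPp :: "'u itself \<Rightarrow> ('m, 'f, 'r) tstruct \<Rightarrow> bool" where
  "injective_IScPp _ Q \<longleftrightarrow>
     (\<forall>(X :: ('u, 'f, 'r) tstruct) \<in> IScPp Q. \<forall>(Y :: ('u, 'f, 'r) tstruct) \<in> IScPp Q.
        \<forall>i f. tembedding X Y i \<and> f \<in> chom X Q \<longrightarrow> (\<exists>g\<in>chom Y Q. compose (carr (fst X)) g i = f))"


section \<open>Alter egos and dualities\<close>

definition alter_ego :: "('m, 'f2, 'r2) tstruct \<Rightarrow> ('m, 'f1, 'r1) struct \<Rightarrow> bool" where
  "alter_ego Q P \<longleftrightarrow> carr (fst Q) = carr P \<and>
     (\<forall>r\<in>relsyms (sg (fst Q)).
        forms_substruct (rln (fst Q) r) (power_struct P {..<rar (fst Q) r})) \<and>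
     (\<forall>g\<in>opsyms (sg (fst Q)).
        restrict (opn (fst Q) g) (tuples (oar (fst Q) g) (carr P))
          \<in> homs (power_struct P {..<oar (fst Q) g}) P) \<and>
     (\<forall>r\<in>relsyms (sg P). closedin (tpower {..<rar P r} (snd Q)) (rln P r)) \<and>
     (\<forall>g\<in>opsyms (sg P). continuous_map (tpower {..<oar P g} (snd Q)) (snd Q) (opn P g))"

definition dual_D ::
    "('m, 'f1, 'r1) struct \<Rightarrow> ('m, 'f2, 'r2) tstruct \<Rightarrow> ('a, 'f1, 'r1) struct
      \<Rightarrow> ('a \<Rightarrow> 'm, 'f2, 'r2) tstruct" where
  "dual_D P Q A = tsubstruct (tpower_struct Q (carr A)) (homs A P)"

definition dual_E ::
    "('m, 'f1, 'r1) struct \<Rightarrow> ('m, 'f2, 'r2) tstruct \<Rightarrow> ('x, 'f2, 'r2) tstruct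
      \<Rightarrow> ('x \<Rightarrow> 'm, 'f1, 'r1) struct" where
  "dual_E P Q X = substruct (power_struct P (carr (fst X))) (chom X Q)"

definition eval_e :: "('m, 'f1, 'r1) struct \<Rightarrow> ('a, 'f1, 'r1) struct \<Rightarrow> 'a \<Rightarrow> ('a \<Rightarrow> 'm) \<Rightarrow> 'm" where
  "eval_e P A = (\<lambda>a\<in>carr A. \<lambda>x\<in>homs A P. x a)"

definition eval_eps ::
    "('m, 'f2, 'r2) tstruct \<Rightarrow> ('x, 'f2, 'r2) tstruct \<Rightarrow> 'x \<Rightarrow> ('x \<Rightarrow> 'm) \<Rightarrow> 'm" where
  "eval_eps Q X = (\<lambda>x\<in>carr (fst X). \<lambda>\<alpha>\<in>chom X Q. \<alpha> x)"

definition fully_dualises ::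
    "'u itself \<Rightarrow> ('m, 'f2, 'r2) tstruct \<Rightarrow> ('m, 'f1, 'r1) struct \<Rightarrow> bool" where
  "fully_dualises _ Q P \<longleftrightarrow> alter_ego Q P \<and>
     (\<forall>(A :: ('u, 'f1, 'r1) struct) \<in> ISP P.
        iso_struct A (dual_E P Q (dual_D P Q A)) (eval_e P A)) \<and>
     (\<forall>(X :: ('u, 'f2, 'r2) tstruct) \<in> IScPp Q.
        iso_tstruct X (dual_D P Q (dual_E P Q X)) (eval_eps Q X))"

definition fully_dualises_inj ::
    "'u itself \<Rightarrow> ('m, 'f2, 'r2) tstruct \<Rightarrow> ('m, 'f1, 'r1) struct \<Rightarrow> bool" where
  "fully_dualises_inj u Q P \<longleftrightarrow>
     fully_dualises u Q P \<and> injective_IScPp u Q \<and> injective_ISP u P"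


section \<open>Term functions, separation and structural reducts\<close>

datatype 'f trm = Var nat | Fn 'f "'f trm list"

text \<open>\<open>wf_trm \<sigma> n t\<close>: \<open>t\<close> is an \<open>n\<close>-ary term over \<open>\<sigma>\<close>, i.e. its variables have indices below \<open>n\<close>.\<close>

fun wf_trm :: "('f, 'r) signature \<Rightarrow> nat \<Rightarrow> 'f trm \<Rightarrow> bool" where
  "wf_trm \<sigma> n (Var i) \<longleftrightarrow> i < n"
| "wf_trm \<sigma> n (Fn f ts) \<longleftrightarrow>
     f \<in> opsyms \<sigma> \<and> length ts = oparity \<sigma> f \<and> (\<forall>t\<in>set ts. wf_trm \<sigma> n t)"

primrec trm_val :: "('a, 'f, 'r) struct \<Rightarrow> (nat \<Rightarrow> 'a) \<Rightarrow> 'f trm \<Rightarrow> 'a" where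
  "trm_val A v (Var i) = v i"
| "trm_val A v (Fn f ts) = opn A f (\<lambda>i\<in>{..<length ts}. map (trm_val A v) ts ! i)"

definition Clo1 :: "('a, 'f, 'r) struct \<Rightarrow> ('a \<Rightarrow> 'a) set" where
  "Clo1 A = {(\<lambda>x\<in>carr A. trm_val A (\<lambda>i\<in>{..<1}. x) t) | t. wf_trm (sg A) 1 t}"

definition comp_set :: "'a set \<Rightarrow> ('a \<Rightarrow> 'b) \<Rightarrow> ('a \<Rightarrow> 'a) set \<Rightarrow> ('a \<Rightarrow> 'b) set" where
  "comp_set A \<omega> Z = {compose A \<omega> u | u. u \<in> Z}"

definition separates_points :: "('a \<Rightarrow> 'b) set \<Rightarrow> 'a set \<Rightarrow> bool" where
  "separates_points Z A \<longleftrightarrow> (\<forall>a\<in>A. \<forall>b\<in>A. a \<noteq> b \<longrightarrow> (\<exists>z\<in>Z. z a \<noteq> z b))"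

definition separates_struct ::
    "('a \<Rightarrow> 'b) set \<Rightarrow> ('a, 'f, 'r) struct \<Rightarrow> ('b, 'f, 'r) struct \<Rightarrow> bool" where
  "separates_struct Z A N \<longleftrightarrow> separates_points Z (carr A) \<and>
     (\<forall>r\<in>relsyms (sg A). \<forall>a \<in> tuples (rar A r) (carr A) - rln A r.
        \<exists>z\<in>Z. compose {..<rar A r} z a \<notin> rln N r)"

datatype ('f, 'r) atm = Eq "'f trm" "'f trm" | Rel 'r "'f trm list"

primrec wf_atm :: "('f, 'r) signature \<Rightarrow> nat \<Rightarrow> ('f, 'r) atm \<Rightarrow> bool" where
  "wf_atm \<sigma> n (Eq s t) \<longleftrightarrow> wf_trm \<sigma> n s \<and> wf_trm \<sigma> n t"
| "wf_atm \<sigma> n (Rel r ts) \<longleftrightarrow>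
     r \<in> relsyms \<sigma> \<and> length ts = relarity \<sigma> r \<and> (\<forall>t\<in>set ts. wf_trm \<sigma> n t)"

primrec atm_holds :: "('a, 'f, 'r) struct \<Rightarrow> (nat \<Rightarrow> 'a) \<Rightarrow> ('f, 'r) atm \<Rightarrow> bool" where
  "atm_holds A v (Eq s t) \<longleftrightarrow> trm_val A v s = trm_val A v t"
| "atm_holds A v (Rel r ts) \<longleftrightarrow> (\<lambda>i\<in>{..<length ts}. trm_val A v (ts ! i)) \<in> rln A r"

text \<open>
  A reduct scheme chooses, for each symbol of the type \<open>\<tau>\<close> of the reduct, a term or a finite
  conjunction of atomic formulas (a list) over the type \<open>\<sigma>\<close> of the given structure. The same scheme
  is applied to the generating structure and to all members of its class.
\<close>

record ('f, 'r, 'g, 'q) scheme =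
  op_trm :: "'g \<Rightarrow> 'f trm"
  rel_fml :: "'q \<Rightarrow> ('f, 'r) atm list"

definition reduct_scheme ::
    "('f, 'r) signature \<Rightarrow> ('g, 'q) signature \<Rightarrow> ('f, 'r, 'g, 'q) scheme \<Rightarrow> bool" where
  "reduct_scheme \<sigma> \<tau> \<rho> \<longleftrightarrow>
     (\<forall>g\<in>opsyms \<tau>. wf_trm \<sigma> (oparity \<tau> g) (op_trm \<rho> g)) \<and>
     (\<forall>r\<in>relsyms \<tau>. \<forall>\<phi>\<in>set (rel_fml \<rho> r). wf_atm \<sigma> (relarity \<tau> r) \<phi>)"

definition flat ::
    "('g, 'q) signature \<Rightarrow> ('f, 'r, 'g, 'q) scheme \<Rightarrow> ('a, 'f, 'r) struct \<Rightarrow> ('a, 'g, 'q) struct" where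
  "flat \<tau> \<rho> A =
     \<lparr>sg = \<tau>,
      carr = carr A,
      opn = (\<lambda>g a. trm_val A a (op_trm \<rho> g)),
      rln = (\<lambda>r. {a \<in> tuples (relarity \<tau> r) (carr A). \<forall>\<phi>\<in>set (rel_fml \<rho> r). atm_holds A a \<phi>})\<rparr>"

definition tflat ::
    "('g, 'q) signature \<Rightarrow> ('f, 'r, 'g, 'q) scheme \<Rightarrow> ('a, 'f, 'r) tstruct \<Rightarrow> ('a, 'g, 'q) tstruct" where
  "tflat \<tau> \<rho> X = (flat \<tau> \<rho> (fst X), snd X)"


section \<open>Maximal relations and entailment\<close>

definition max_rels ::
    "('a, 'f, 'r) struct \<Rightarrow> ('a \<Rightarrow> 'b) \<Rightarrow> nat \<Rightarrow> (nat \<Rightarrow> 'b) set \<Rightarrow> (nat \<Rightarrow> 'a) set set" where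
  "max_rels M \<omega> n r =
     (let C = {s. forms_substruct s (power_struct M {..<n}) \<and>
                  s \<subseteq> {a \<in> tuples n (carr M). compose {..<n} \<omega> a \<in> r}}
      in {s \<in> C. \<forall>s'\<in>C. s \<subseteq> s' \<longrightarrow> s' = s})"

text \<open>\<open>u\<close> is defined on a set \<open>H\<close> of maps from \<open>A\<close>; the relation \<open>s\<close> is lifted pointwise to \<open>H\<close>.\<close>

definition preserves_lifted ::
    "nat \<Rightarrow> (nat \<Rightarrow> 'm) set \<Rightarrow> 'a set \<Rightarrow> ('a \<Rightarrow> 'm) set \<Rightarrow> (('a \<Rightarrow> 'm) \<Rightarrow> 'm) \<Rightarrow> bool" where
  "preserves_lifted n s A H u \<longleftrightarrow>
     (\<forall>x\<in>tuples n H. (\<forall>a\<in>A. (\<lambda>i\<in>{..<n}. x i a) \<in> s) \<longrightarrow> compose {..<n} u x \<in> s)"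

text \<open>\<open>M2\<close> with its topology entails \<open>s\<close>, relative to \<open>M1\<close> without topology.\<close>

definition top_entails ::
    "'u itself \<Rightarrow> ('m, 'f1, 'r1) struct \<Rightarrow> ('m, 'f2, 'r2) tstruct \<Rightarrow> nat \<Rightarrow> (nat \<Rightarrow> 'm) set \<Rightarrow> bool" where
  "top_entails _ M1 M2 n s \<longleftrightarrow> forms_substruct s (power_struct M1 {..<n}) \<and>
     (\<forall>(A :: ('u, 'f1, 'r1) struct) \<in> ISP M1. \<forall>\<alpha> \<in> chom (dual_D M1 M2 A) M2.
        preserves_lifted n s (carr A) (homs A M1) \<alpha>)"

text \<open>\<open>M2\<close> without topology entails \<open>s\<close>, relative to \<open>M1\<close> with its topology.\<close>

definition alg_entails ::
    "'u itself \<Rightarrow> ('m, 'f1, 'r1) tstruct \<Rightarrow> ('m, 'f2, 'r2) struct \<Rightarrow> nat \<Rightarrow> (nat \<Rightarrow> 'm) set \<Rightarrow> bool" where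
  "alg_entails _ M1 M2 n s \<longleftrightarrow> forms_closed_substruct s (tpower_struct M1 {..<n}) \<and>
     (\<forall>(X :: ('u, 'f1, 'r1) tstruct) \<in> IScPp M1. \<forall>u \<in> homs (dual_E M2 M1 X) M2.
        preserves_lifted n s (carr (fst X)) (chom X M1) u)"

end

theory Submission
  imports Defs
begin

text \<open>
  Both hypotheses (I) and (II) imply the symmetric pair of conditions that \<open>\<omega> \<circ> Clo\<^sub>1(M\<^sub>2)\<close> separates the
  structure \<open>M\<^sub>1\<^sup>\<flat>\<close> and \<open>\<omega> \<circ> Clo\<^sub>1(M\<^sub>1)\<close> separates \<open>M\<^sub>2\<^sup>\<flat>\<close>; by this symmetry it is enough to treat one
  of the two directions. Unary terms of \<open>M\<^sub>1\<close> commute with morphisms into \<open>M\<^sub>1\<close> and act on morphisms into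
  \<open>M\<^sub>2\<^sup>T\<close>, so \<open>x \<mapsto> \<omega> \<circ> x\<close> embeds the dual of \<open>A\<close> into the dual of \<open>A\<^sup>\<flat>\<close>, and its image separates the
  structure \<open>A\<^sup>\<flat>\<close>. For a full duality with injective generators, a closed substructure of a dual that
  separates the structure is the whole dual. This gives the isomorphisms in (c). Composing with \<open>\<omega>\<close>
  then reduces full duality and injectivity for \<open>M\<^sub>1, M\<^sub>2\<close> to the same properties of \<open>N\<^sub>1, N\<^sub>2\<close>.
\<close>

section \<open>Homomorphisms, terms and separation\<close>

text \<open>The two separation conditions do different work. For \<open>A\<close> in
  \<open>ISP M1\<close>, the map x \<mapsto> \<omega> \<circ> x is an embedding because \<omega>
  after the unary terms of \<open>M1\<close> separates the reduct of \<open>M2\<close>: a term of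
  \<open>M1\<close> turns the evaluation at \<open>a\<close> into the evaluation at another element
  of \<open>A\<close>, so the term can be absorbed. Its image separates the reduct of
  \<open>A\<close> because \<omega> after the unary terms of \<open>M2\<close> separates the reduct
  of \<open>M1\<close>, and these terms are absorbed by the morphisms, which are closed under them.
  On the topological side the two conditions change places.

  The obstacle is surjectivity: nothing about \<omega> lifts a morphism into \<open>N1\<close> to
  one into \<open>M1\<close>, so preimages can only come from the duality between \<open>N1\<close>
  and \<open>N2\<close>.

  Separation is the common currency. An embedding is a homomorphism \<open>f\<close> for which
  \<open>{f}\<close> separates, membership in a generated class is separation by morphisms, and
  separation composes. In this form it passes to reducts, since atomic formulas are reflected by
  separating families of homomorphisms.\<close>

lemma struct_sel_simps [simp]:
  "sg (power_struct P S) = sg P" "sg (substruct A U) = sg A" "sg (flat \<tau> \<rho> A) = \<tau>"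
  "carr (power_struct P S) = S \<rightarrow>\<^sub>E carr P" "carr (substruct A U) = U" "carr (flat \<tau> \<rho> A) = carr A"
  "opn (substruct A U) = opn A" "rln (substruct A U) r = rln A r \<inter> tuples (rar A r) U"
  by (auto simp: power_struct_def substruct_def flat_def)

lemma tuple_nth: "a \<in> tuples n A \<Longrightarrow> i < n \<Longrightarrow> a i \<in> A"
  by auto

lemma compose_in_tuples:
  "f \<in> A \<rightarrow> B \<Longrightarrow> a \<in> tuples n A \<Longrightarrow> compose {..<n} f a \<in> tuples n B"
  by (auto simp: compose_def)

lemma compose_compose_tuple:
  "a \<in> tuples n A \<Longrightarrow> compose {..<n} (compose A g f) a = compose {..<n} g (compose {..<n} f a)"
  by (auto simp: compose_def fun_eq_iff)

lemma opn_closed: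
  "is_struct A \<Longrightarrow> g \<in> opsyms (sg A) \<Longrightarrow> a \<in> tuples (oar A g) (carr A) \<Longrightarrow> opn A g a \<in> carr A"
  by (auto simp: is_struct_def)

lemma rln_tuples: "is_struct A \<Longrightarrow> r \<in> relsyms (sg A) \<Longrightarrow> a \<in> rln A r \<Longrightarrow> a \<in> tuples (rar A r) (carr A)"
  unfolding is_struct_def by blast

lemma homsI:
  assumes "f \<in> carr A \<rightarrow>\<^sub>E carr B" "sg A = sg B"
    "\<And>g a. g \<in> opsyms (sg A) \<Longrightarrow> a \<in> tuples (oar A g) (carr A)
       \<Longrightarrow> f (opn A g a) = opn B g (compose {..<oar A g} f a)"
    "\<And>r a. r \<in> relsyms (sg A) \<Longrightarrow> a \<in> rln A r \<Longrightarrow> compose {..<rar A r} f a \<in> rln B r"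
  shows "f \<in> homs A B"
  using assms unfolding homs_def by blast

lemma homs_PiE: "f \<in> homs A B \<Longrightarrow> f \<in> carr A \<rightarrow>\<^sub>E carr B"
  and homs_sg: "f \<in> homs A B \<Longrightarrow> sg A = sg B"
  and homs_opn: "f \<in> homs A B \<Longrightarrow> g \<in> opsyms (sg A) \<Longrightarrow> a \<in> tuples (oar A g) (carr A)
       \<Longrightarrow> f (opn A g a) = opn B g (compose {..<oar A g} f a)"
  and homs_rln: "f \<in> homs A B \<Longrightarrow> r \<in> relsyms (sg A) \<Longrightarrow> a \<in> rln A r
       \<Longrightarrow> compose {..<rar A r} f a \<in> rln B r"
  unfolding homs_def by blast+

lemma homs_Pi: "f \<in> homs A B \<Longrightarrow> f \<in> carr A \<rightarrow> carr B"
  using homs_PiE by (auto simp: PiE_def)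

lemma homs_comp:
  assumes A: "is_struct A" and f: "f \<in> homs A B" and h: "h \<in> homs B C"
  shows "compose (carr A) h f \<in> homs A C"
proof (rule homsI)
  show "compose (carr A) h f \<in> carr A \<rightarrow>\<^sub>E carr C"
    using homs_PiE[OF f] homs_PiE[OF h] by (auto simp: compose_def)
  show sg: "sg A = sg C" using homs_sg[OF f] homs_sg[OF h] by simp
  fix g a assume g: "g \<in> opsyms (sg A)" and a: "a \<in> tuples (oar A g) (carr A)"
  have "compose {..<oar A g} f a \<in> tuples (oar B g) (carr B)"
    using compose_in_tuples[OF homs_Pi[OF f] a] homs_sg[OF f] by simp
  then show "compose (carr A) h f (opn A g a) = opn C g (compose {..<oar A g} (compose (carr A) h f) a)"
    using homs_opn[OF f g a] homs_opn[OF h, of g] g opn_closed[OF A g a] homs_sg[OF f]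
      compose_compose_tuple[OF a, of h f]
    by (simp add: compose_eq)
next
  fix r a assume r: "r \<in> relsyms (sg A)" and a: "a \<in> rln A r"
  show "compose {..<rar A r} (compose (carr A) h f) a \<in> rln C r"
    using homs_rln[OF h _ homs_rln[OF f r a]] r homs_sg[OF f]
      compose_compose_tuple[OF rln_tuples[OF A r a], of h f] by simp
qed

lemma separates_structD_points:
  "separates_struct Z A N \<Longrightarrow> a \<in> carr A \<Longrightarrow> b \<in> carr A \<Longrightarrow> (\<And>z. z \<in> Z \<Longrightarrow> z a = z b) \<Longrightarrow> a = b"
  unfolding separates_struct_def separates_points_def by blast

lemma separates_structD_rln:
  "separates_struct Z A N \<Longrightarrow> r \<in> relsyms (sg A) \<Longrightarrow> a \<in> tuples (rar A r) (carr A)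
   \<Longrightarrow> (\<And>z. z \<in> Z \<Longrightarrow> compose {..<rar A r} z a \<in> rln N r) \<Longrightarrow> a \<in> rln A r"
  unfolding separates_struct_def by blast

lemma separates_structI:
  assumes "\<And>a b. a \<in> carr A \<Longrightarrow> b \<in> carr A \<Longrightarrow> (\<And>z. z \<in> Z \<Longrightarrow> z a = z b) \<Longrightarrow> a = b"
    "\<And>r a. r \<in> relsyms (sg A) \<Longrightarrow> a \<in> tuples (rar A r) (carr A)
       \<Longrightarrow> (\<And>z. z \<in> Z \<Longrightarrow> compose {..<rar A r} z a \<in> rln N r) \<Longrightarrow> a \<in> rln A r"
  shows "separates_struct Z A N"
  unfolding separates_struct_def separates_points_def using assms by (metis Diff_iff)

lemma separates_struct_mono:
  "separates_struct Z A N \<Longrightarrow> Z \<subseteq> Z' \<Longrightarrow> separates_struct Z' A N"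
  unfolding separates_struct_def separates_points_def by blast

lemma is_struct_power:
  assumes P: "is_struct P"
  shows "is_struct (power_struct P S)"
  unfolding is_struct_def
proof (intro conjI ballI)
  fix g a assume g: "g \<in> opsyms (sg (power_struct P S))"
    and a: "a \<in> tuples (oar (power_struct P S) g) (carr (power_struct P S))"
  have "(\<lambda>i\<in>{..<oar P g}. a i s) \<in> tuples (oar P g) (carr P)" if "s \<in> S" for s
    using a that by (auto simp: power_struct_def)
  then show "opn (power_struct P S) g a \<in> carr (power_struct P S)"
    using opn_closed[OF P] g by (auto simp: power_struct_def)
qed (auto simp: power_struct_def)

lemma is_struct_substruct: "subuniverse U A \<Longrightarrow> is_struct A \<Longrightarrow> is_struct (substruct A U)"
  by (auto simp: is_struct_def subuniverse_def)

lemma homs_substruct_iff: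
  assumes A: "is_struct A" and U: "U \<subseteq> carr B"
  shows "f \<in> homs A (substruct B U) \<longleftrightarrow> f \<in> homs A B \<and> f ` carr A \<subseteq> U"
proof
  assume f: "f \<in> homs A (substruct B U)"
  then have fU: "f ` carr A \<subseteq> U" using homs_Pi by fastforce
  have "f \<in> homs A B"
  proof (rule homsI)
    show "f \<in> carr A \<rightarrow>\<^sub>E carr B"
      using homs_PiE[OF f] U by (auto simp: PiE_def)
    show "sg A = sg B" using homs_sg[OF f] by simp
    show "f (opn A g a) = opn B g (compose {..<oar A g} f a)"
      if "g \<in> opsyms (sg A)" "a \<in> tuples (oar A g) (carr A)" for g a
      using homs_opn[OF f that] by simp
    show "compose {..<rar A r} f a \<in> rln B r" if "r \<in> relsyms (sg A)" "a \<in> rln A r" for r a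
      using homs_rln[OF f that] by simp
  qed
  with fU show "f \<in> homs A B \<and> f ` carr A \<subseteq> U" by blast
next
  assume "f \<in> homs A B \<and> f ` carr A \<subseteq> U"
  then have f: "f \<in> homs A B" and p: "f \<in> carr A \<rightarrow> U" by auto
  show "f \<in> homs A (substruct B U)"
  proof (rule homsI)
    show "f \<in> carr A \<rightarrow>\<^sub>E carr (substruct B U)"
      using homs_PiE[OF f] p by (simp add: PiE_def)
    show "sg A = sg (substruct B U)" using homs_sg[OF f] by simp
    show "f (opn A g a) = opn (substruct B U) g (compose {..<oar A g} f a)"
      if "g \<in> opsyms (sg A)" "a \<in> tuples (oar A g) (carr A)" for g a
      using homs_opn[OF f that] by simp
    show "compose {..<rar A r} f a \<in> rln (substruct B U) r"
      if "r \<in> relsyms (sg A)" "a \<in> rln A r" for r a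
      using homs_rln[OF f that] compose_in_tuples[OF p rln_tuples[OF A that]] homs_sg[OF f] by simp
  qed
qed

lemma homs_substruct_dom:
  assumes f: "f \<in> homs A B" and U: "subuniverse U A"
  shows "restrict f U \<in> homs (substruct A U) B"
proof (rule homsI)
  have c: "compose {..<n} (restrict f U) a = compose {..<n} f a" if "a \<in> tuples n U" for n a
    using that by (auto simp: compose_def fun_eq_iff)
  show "restrict f U \<in> carr (substruct A U) \<rightarrow>\<^sub>E carr B"
    using homs_Pi[OF f] U by (auto simp: subuniverse_def)
  show "sg (substruct A U) = sg B" using homs_sg[OF f] by simp
  show "restrict f U (opn (substruct A U) g a) = opn B g (compose {..<oar (substruct A U) g} (restrict f U) a)"
    if g: "g \<in> opsyms (sg (substruct A U))"
      and a: "a \<in> tuples (oar (substruct A U) g) (carr (substruct A U))" for g a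
  proof -
    have "a \<in> tuples (oar A g) (carr A)" using a U by (auto simp: subuniverse_def PiE_iff)
    moreover have "opn A g a \<in> U" using U g a by (auto simp: subuniverse_def)
    ultimately show ?thesis using homs_opn[OF f, of g a] g c[of a "oar A g"] a by simp
  qed
  show "compose {..<rar (substruct A U) r} (restrict f U) a \<in> rln B r"
    if "r \<in> relsyms (sg (substruct A U))" "a \<in> rln (substruct A U) r" for r a
    using homs_rln[OF f, of r a] that c[of a "rar A r"] by simp
qed

text \<open>\<open>separates_struct {f} A B\<close> says that \<open>f\<close> is injective and reflects the relations.\<close>

lemma iso_struct_image:
  assumes A: "is_struct A" and f: "f \<in> homs A B" and s: "separates_struct {f} A B"
  shows "subuniverse (f ` carr A) B" "iso_struct A (substruct B (f ` carr A)) f"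
proof -
  let ?U = "f ` carr A"
  let ?i = "restrict (inv_into (carr A) f) ?U"
  have sg: "sg B = sg A" using homs_sg[OF f] by simp
  have inj: "inj_on f (carr A)"
    by (rule inj_onI) (use separates_structD_points[OF s] in blast)
  have i: "compose {..<n} ?i a \<in> tuples n (carr A)"
      "compose {..<n} f (compose {..<n} ?i a) = a" if "a \<in> tuples n ?U" for n a
  proof -
    show "compose {..<n} ?i a \<in> tuples n (carr A)"
      by (rule compose_in_tuples[OF _ that]) (auto simp: inv_into_into)
    \<comment> \<open>Off the index range both tuples are \<open>undefined\<close>, so only indices
      below \<open>n\<close> involve the inverse.\<close>
    show "compose {..<n} f (compose {..<n} ?i a) = a"
    proof
      fix j show "compose {..<n} f (compose {..<n} ?i a) j = a j"
      proof (cases "j < n")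
        case True
        then have "a j \<in> ?U" using tuple_nth[OF that] by blast
        then show ?thesis using True f_inv_into_f[of "a j" f "carr A"] by (simp add: compose_def)
      qed (simp add: compose_def PiE_arb[OF that])
    qed
  qed
  \<comment> \<open>A tuple over the image is the image of its preimage tuple, so an operation of
    \<open>B\<close> on it is \<open>f\<close> of an operation of \<open>A\<close>. This yields
    closure of the image and, by injectivity, compatibility of the inverse with the
    operations.\<close>
  have op: "opn A g (compose {..<oar A g} ?i a) \<in> carr A"
    "opn B g a = f (opn A g (compose {..<oar A g} ?i a))"
    if "g \<in> opsyms (sg A)" "a \<in> tuples (oar A g) ?U" for g a
    using homs_opn[OF f that(1) i(1)[OF that(2)]] i(2)[OF that(2)] opn_closed[OF A that(1) i(1)[OF that(2)]]
    by simp_all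
  have UB: "?U \<subseteq> carr B" using homs_Pi[OF f] by blast
  show sub: "subuniverse ?U B"
    unfolding subuniverse_def sg using UB op by (metis imageI)
  show "iso_struct A (substruct B ?U) f"
    unfolding iso_struct_def
  proof (intro conjI)
    show "f \<in> homs A (substruct B ?U)"
      using f UB by (subst homs_substruct_iff) (auto simp: A)
    show "bij_betw f (carr A) (carr (substruct B ?U))" using inj by (simp add: bij_betw_def)
    have "?i \<in> homs (substruct B ?U) A"
    proof (rule homsI)
      show "?i \<in> carr (substruct B ?U) \<rightarrow>\<^sub>E carr A" by (auto simp: inv_into_into)
      show "sg (substruct B ?U) = sg A" by (simp add: sg)
    next
      fix g a assume "g \<in> opsyms (sg (substruct B ?U))"
        and "a \<in> tuples (oar (substruct B ?U) g) (carr (substruct B ?U))"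
      then have g: "g \<in> opsyms (sg A)" and a: "a \<in> tuples (oar A g) ?U" by (simp_all add: sg)
      then show "?i (opn (substruct B ?U) g a) = opn A g (compose {..<oar (substruct B ?U) g} ?i a)"
        using op[OF g a] inj by (simp add: sg)
    next
      fix r a assume "r \<in> relsyms (sg (substruct B ?U))" and "a \<in> rln (substruct B ?U) r"
      then have r: "r \<in> relsyms (sg A)" and a: "a \<in> tuples (rar A r) ?U" "a \<in> rln B r"
        by (simp_all add: sg)
      have "compose {..<rar A r} ?i a \<in> rln A r"
        by (rule separates_structD_rln[OF s r i(1)[OF a(1)]]) (simp add: i(2)[OF a(1)] a(2))
      then show "compose {..<rar (substruct B ?U) r} ?i a \<in> rln A r" by (simp add: sg)
    qed
    then show "restrict (inv_into (carr A) f) (carr (substruct B ?U)) \<in> homs (substruct B ?U) A"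
      by simp
  qed
qed

text \<open>Relations are reflected because the inverse homomorphism carries the image tuple back to
  the original one. Together with \<open>iso_struct_image\<close> this replaces isomorphisms onto
  substructures by separation.\<close>

lemma iso_substruct_imp:
  assumes A: "is_struct A" and U: "subuniverse U B" and iso: "iso_struct A (substruct B U) f"
  shows "f \<in> homs A B" "separates_struct {f} A B" "f ` carr A = U"
proof -
  let ?i = "restrict (inv_into (carr A) f) U"
  have fU: "f \<in> homs A (substruct B U)" and bij: "bij_betw f (carr A) U"
    and inv: "?i \<in> homs (substruct B U) A"
    using iso by (auto simp: iso_struct_def)
  show f: "f \<in> homs A B" using fU U homs_substruct_iff[OF A] by (auto simp: subuniverse_def)
  have inj: "inj_on f (carr A)" and fA: "f ` carr A = U" using bij by (auto simp: bij_betw_def)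
  show "f ` carr A = U" by (fact fA)
  have sg: "sg B = sg A" using homs_sg[OF f] by simp
  show "separates_struct {f} A B"
  proof (rule separates_structI)
    fix r a assume r: "r \<in> relsyms (sg A)" and a: "a \<in> tuples (rar A r) (carr A)"
      and z: "\<And>z. z \<in> {f} \<Longrightarrow> compose {..<rar A r} z a \<in> rln B r"
    have "compose {..<rar A r} f a \<in> rln (substruct B U) r"
      using z compose_in_tuples[of f "carr A" U a "rar A r"] a fA by (auto simp: sg)
    then have "compose {..<rar A r} ?i (compose {..<rar A r} f a) \<in> rln A r"
      using homs_rln[OF inv, of r] r by (simp add: sg)
    moreover have "compose {..<rar A r} ?i (compose {..<rar A r} f a) = a"
    proof
      fix j show "compose {..<rar A r} ?i (compose {..<rar A r} f a) j = a j"
      proof (cases "j < rar A r")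
        case True
        then have "a j \<in> carr A" using tuple_nth[OF a] by blast
        then show ?thesis using True inj fA by (auto simp: compose_def)
      qed (simp add: compose_def PiE_arb[OF a])
    qed
    ultimately show "a \<in> rln A r" by simp
  qed (use inj in \<open>auto dest: inj_onD\<close>)
qed

text \<open>The substructure can only be the image of \<open>f\<close>, so the existential
  disappears. The condition on the carrier reflects that substructures without topology are
  non-empty.\<close>

lemma embedding_iff:
  assumes A: "is_struct A"
  shows "embedding A B f \<longleftrightarrow> f \<in> homs A B \<and> separates_struct {f} A B \<and> carr A \<noteq> {}"
proof
  assume "embedding A B f"
  then obtain U where "U \<noteq> {}" "subuniverse U B" "iso_struct A (substruct B U) f"
    unfolding embedding_def forms_substruct_def by blast
  then show "f \<in> homs A B \<and> separates_struct {f} A B \<and> carr A \<noteq> {}"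
    using iso_substruct_imp[OF A] by blast
next
  assume "f \<in> homs A B \<and> separates_struct {f} A B \<and> carr A \<noteq> {}"
  then show "embedding A B f"
    using iso_struct_image[OF A, of f B] unfolding embedding_def forms_substruct_def
    by (intro exI[of _ "f ` carr A"]) simp
qed

lemma subuniverse_carr: "is_struct A \<Longrightarrow> subuniverse (carr A) A"
  by (simp add: subuniverse_def is_struct_def)

lemma iso_struct_iff:
  assumes A: "is_struct A" and B: "is_struct B"
  shows "iso_struct A B f \<longleftrightarrow> f \<in> homs A B \<and> separates_struct {f} A B \<and> f ` carr A = carr B"
proof -
  let ?B = "substruct B (carr B)"
  \<comment> \<open>\<open>substruct B (carr B)\<close> may differ from \<open>B\<close>, since
    \<open>rln\<close> is unconstrained on symbols outside the signature. Both have the same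
    homomorphisms to and from \<open>A\<close>, and that is all an isomorphism sees.\<close>
  have r: "rln B r \<inter> tuples (rar B r) (carr B) = rln B r" if "r \<in> relsyms (sg B)" for r
    using rln_tuples[OF B that] by auto
  have "homs A ?B = homs A B"
    using homs_substruct_iff[OF A, of "carr B" B] homs_Pi by fastforce
  moreover have "homs ?B A = homs B A"
    unfolding homs_def by (simp add: r cong: ball_cong)
  ultimately have eq: "homs A ?B = homs A B" "homs ?B A = homs B A" by blast+
  have 1: "iso_struct A ?B f = iso_struct A B f"
    by (simp add: iso_struct_def eq)
  show ?thesis
  proof
    assume "iso_struct A B f"
    then show "f \<in> homs A B \<and> separates_struct {f} A B \<and> f ` carr A = carr B"
      using iso_substruct_imp[OF A subuniverse_carr[OF B]] 1 by simp
  next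
    assume "f \<in> homs A B \<and> separates_struct {f} A B \<and> f ` carr A = carr B"
    then show "iso_struct A B f" using iso_struct_image(2)[OF A, of f B] 1 by simp
  qed
qed

text \<open>Closure and compatibility go through one induction: \<open>h\<close> commutes with the
  outermost operation only if the values of the subterms are already known to lie in the
  carrier.\<close>

lemma trm_val_hom:
  assumes A: "is_struct A" and h: "h \<in> homs A B" and v: "v \<in> tuples n (carr A)"
  shows "wf_trm (sg A) n t \<Longrightarrow> trm_val A v t \<in> carr A \<and> h (trm_val A v t) = trm_val B (compose {..<n} h v) t"
proof (induction t)
  case (Var i)
  then show ?case using v by (auto simp: compose_def)
next
  case (Fn f ts)
  let ?a = "\<lambda>i\<in>{..<length ts}. map (trm_val A v) ts ! i"
  have f: "f \<in> opsyms (sg A)" and len: "length ts = oar A f" using Fn.prems by auto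
  have nth: "trm_val A v (ts ! i) \<in> carr A \<and> h (trm_val A v (ts ! i)) = trm_val B (compose {..<n} h v) (ts ! i)"
    if "i < length ts" for i
    using Fn that by auto
  then have a: "?a \<in> tuples (oar A f) (carr A)" using len by auto
  have "compose {..<oar A f} h ?a = (\<lambda>i\<in>{..<length ts}. map (trm_val B (compose {..<n} h v)) ts ! i)"
    using nth len by (auto simp: compose_def fun_eq_iff)
  then show ?case using homs_opn[OF h f a] opn_closed[OF A f a] by simp
qed

lemma compose_id_tuple:
  assumes a: "a \<in> tuples n A"
  shows "compose {..<n} (\<lambda>x\<in>A. x) a = a"
proof
  fix j show "compose {..<n} (\<lambda>x\<in>A. x) a j = a j"
    using tuple_nth[OF a, of j] PiE_arb[OF a, of j] by (cases "j < n") (simp_all add: compose_def)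
qed

lemma homs_id:
  assumes A: "is_struct A"
  shows "(\<lambda>x\<in>carr A. x) \<in> homs A A"
proof (rule homsI)
  show "(\<lambda>x\<in>carr A. x) (opn A g a) = opn A g (compose {..<oar A g} (\<lambda>x\<in>carr A. x) a)"
    if "g \<in> opsyms (sg A)" "a \<in> tuples (oar A g) (carr A)" for g a
    using opn_closed[OF A that] compose_id_tuple[OF that(2)] by simp
  show "compose {..<rar A r} (\<lambda>x\<in>carr A. x) a \<in> rln A r" if "r \<in> relsyms (sg A)" "a \<in> rln A r" for r a
    using compose_id_tuple[OF rln_tuples[OF A that]] that by simp
qed auto

lemma trm_val_closed:
  "is_struct A \<Longrightarrow> v \<in> tuples n (carr A) \<Longrightarrow> wf_trm (sg A) n t \<Longrightarrow> trm_val A v t \<in> carr A"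
  using trm_val_hom[OF _ homs_id] by blast

lemma trm_val_tuple_hom:
  assumes A: "is_struct A" and h: "h \<in> homs A B" and v: "v \<in> tuples n (carr A)"
    and wf: "\<forall>t\<in>set ts. wf_trm (sg A) n t"
  shows "compose {..<length ts} h (\<lambda>i\<in>{..<length ts}. trm_val A v (ts ! i))
    = (\<lambda>i\<in>{..<length ts}. trm_val B (compose {..<n} h v) (ts ! i))"
  using trm_val_hom[OF A h v] wf by (auto simp: compose_def fun_eq_iff)

lemma atm_holds_hom:
  assumes "is_struct A" "h \<in> homs A B" "v \<in> tuples n (carr A)" "wf_atm (sg A) n \<phi>" "atm_holds A v \<phi>"
  shows "atm_holds B (compose {..<n} h v) \<phi>"
proof (cases \<phi>)
  case (Eq s t)
  then show ?thesis using assms trm_val_hom[OF assms(1-3)] by simp metis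
next
  case (Rel r ts)
  then show ?thesis using assms trm_val_tuple_hom[OF assms(1-3), of ts]
      homs_rln[OF assms(2), of r "\<lambda>i\<in>{..<length ts}. trm_val A v (ts ! i)"] by simp
qed

text \<open>An equation is reflected by separation of points, a relational atom by separation of
  relations, each applied to term values, which homomorphisms respect. Conjunctions follow, and this
  is what carries separation over to reducts.\<close>

lemma atm_holds_separates:
  assumes A: "is_struct A" and Z: "Z \<subseteq> homs A B" and s: "separates_struct Z A B"
    and v: "v \<in> tuples n (carr A)" and wf: "wf_atm (sg A) n \<phi>"
    and hold: "\<And>z. z \<in> Z \<Longrightarrow> atm_holds B (compose {..<n} z v) \<phi>"
  shows "atm_holds A v \<phi>"
proof (cases \<phi>)
  case (Eq s' t)
  have wf': "wf_trm (sg A) n s'" "wf_trm (sg A) n t" using Eq wf by simp_all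
  have "trm_val A v s' = trm_val A v t"
  proof (rule separates_structD_points[OF s trm_val_closed[OF A v wf'(1)] trm_val_closed[OF A v wf'(2)]])
    fix z assume z: "z \<in> Z"
    then have "z \<in> homs A B" using Z by blast
    from trm_val_hom[OF A this v wf'(1)] trm_val_hom[OF A this v wf'(2)] hold[OF z] Eq
    show "z (trm_val A v s') = z (trm_val A v t)" by simp
  qed
  then show ?thesis using Eq by simp
next
  case (Rel r ts)
  have "(\<lambda>i\<in>{..<length ts}. trm_val A v (ts ! i)) \<in> rln A r"
  proof (rule separates_structD_rln[OF s])
    show "(\<lambda>i\<in>{..<length ts}. trm_val A v (ts ! i)) \<in> tuples (rar A r) (carr A)"
      using trm_val_closed[OF A v] wf Rel by auto
    fix z assume z: "z \<in> Z"
    then have "z \<in> homs A B" using Z by blast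
    from trm_val_tuple_hom[OF A this v, of ts] hold[OF z] wf Rel
    show "compose {..<rar A r} z (\<lambda>i\<in>{..<length ts}. trm_val A v (ts ! i)) \<in> rln B r" by simp
  qed (use wf Rel in auto)
  then show ?thesis using Rel by simp
qed

section \<open>Reducts along a scheme of terms and formulas\<close>

lemma is_struct_flat: "is_struct A \<Longrightarrow> reduct_scheme (sg A) \<tau> \<rho> \<Longrightarrow> is_struct (flat \<tau> \<rho> A)"
  unfolding is_struct_def[of "flat \<tau> \<rho> A"] using trm_val_closed[of A]
  by (auto simp: flat_def reduct_scheme_def)

lemma homs_flat:
  assumes A: "is_struct A" and \<rho>: "reduct_scheme (sg A) \<tau> \<rho>" and h: "h \<in> homs A B"
  shows "h \<in> homs (flat \<tau> \<rho> A) (flat \<tau> \<rho> B)"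
proof (rule homsI)
  show "h \<in> carr (flat \<tau> \<rho> A) \<rightarrow>\<^sub>E carr (flat \<tau> \<rho> B)" using homs_PiE[OF h] by simp
next
  fix g a assume "g \<in> opsyms (sg (flat \<tau> \<rho> A))" "a \<in> tuples (oar (flat \<tau> \<rho> A) g) (carr (flat \<tau> \<rho> A))"
  then show "h (opn (flat \<tau> \<rho> A) g a) = opn (flat \<tau> \<rho> B) g (compose {..<oar (flat \<tau> \<rho> A) g} h a)"
    using trm_val_hom[OF A h] \<rho> by (auto simp: flat_def reduct_scheme_def)
next
  fix r a assume "r \<in> relsyms (sg (flat \<tau> \<rho> A))" "a \<in> rln (flat \<tau> \<rho> A) r"
  then show "compose {..<rar (flat \<tau> \<rho> A) r} h a \<in> rln (flat \<tau> \<rho> B) r"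
    using atm_holds_hom[OF A h] \<rho> compose_in_tuples[OF homs_Pi[OF h]]
    by (auto simp: flat_def reduct_scheme_def)
qed simp

lemma separates_struct_flat:
  assumes A: "is_struct A" and \<rho>: "reduct_scheme (sg A) \<tau> \<rho>" and Z: "Z \<subseteq> homs A B"
    and s: "separates_struct Z A B"
  shows "separates_struct Z (flat \<tau> \<rho> A) (flat \<tau> \<rho> B)"
proof (rule separates_structI)
  fix r a assume r: "r \<in> relsyms (sg (flat \<tau> \<rho> A))"
    and a: "a \<in> tuples (rar (flat \<tau> \<rho> A) r) (carr (flat \<tau> \<rho> A))"
    and z: "\<And>z. z \<in> Z \<Longrightarrow> compose {..<rar (flat \<tau> \<rho> A) r} z a \<in> rln (flat \<tau> \<rho> B) r"
  show "a \<in> rln (flat \<tau> \<rho> A) r"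
    using r a z \<rho> atm_holds_separates[OF A Z s, of a "relarity \<tau> r"]
    by (auto simp: flat_def reduct_scheme_def)
qed (auto intro: separates_structD_points[OF s])

section \<open>Powers and the generated classes\<close>

text \<open>Some \<open>z\<close> carries a distinction made in \<open>A\<close> over to
  \<open>B\<close>, and then some \<open>w\<close> carries it to \<open>C\<close>. \<open>V\<close>
  need only contain the composites, so terms hidden inside \<open>w\<close> can be absorbed into
  \<open>V\<close>.\<close>

lemma separates_struct_comp:
  assumes Z: "Z \<subseteq> homs A B" and sZ: "separates_struct Z A B" and sW: "separates_struct W B C"
    and V: "\<And>z w. z \<in> Z \<Longrightarrow> w \<in> W \<Longrightarrow> compose (carr A) w z \<in> V"
  shows "separates_struct V A C"
proof (rule separates_structI)
  fix a b assume a: "a \<in> carr A" and b: "b \<in> carr A" and eq: "\<And>v. v \<in> V \<Longrightarrow> v a = v b"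
  show "a = b"
  proof (rule separates_structD_points[OF sZ a b])
    fix z assume z: "z \<in> Z"
    then have "z \<in> homs A B" using Z by blast
    note zA = homs_Pi[OF this]
    show "z a = z b"
      by (rule separates_structD_points[OF sW funcset_mem[OF zA a] funcset_mem[OF zA b]])
        (use eq[OF V[OF z]] a b in \<open>simp add: compose_eq\<close>)
  qed
next
  fix r a assume r: "r \<in> relsyms (sg A)" and a: "a \<in> tuples (rar A r) (carr A)"
    and V': "\<And>v. v \<in> V \<Longrightarrow> compose {..<rar A r} v a \<in> rln C r"
  show "a \<in> rln A r"
  proof (rule separates_structD_rln[OF sZ r a])
    fix z assume z: "z \<in> Z"
    then have zh: "z \<in> homs A B" using Z by blast
    then have sg: "sg B = sg A" by (simp add: homs_sg)
    have "compose {..<rar A r} z a \<in> rln B r"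
    proof (rule separates_structD_rln[OF sW])
      show "r \<in> relsyms (sg B)" using r by (simp add: sg)
      show "compose {..<rar A r} z a \<in> tuples (rar B r) (carr B)"
        using compose_in_tuples[OF homs_Pi[OF zh] a] by (simp add: sg)
      show "compose {..<rar B r} w (compose {..<rar A r} z a) \<in> rln C r" if "w \<in> W" for w
        using V'[OF V[OF z that]] compose_compose_tuple[OF a, of w z] by (simp add: sg)
    qed
    then show "compose {..<rar A r} z a \<in> rln B r" .
  qed
qed

lemma inclusion_homs:
  assumes B: "is_struct B" and U: "subuniverse U B"
  shows "(\<lambda>x\<in>U. x) \<in> homs (substruct B U) B" "separates_struct {\<lambda>x\<in>U. x} (substruct B U) B"
proof -
  have "restrict (\<lambda>x\<in>carr B. x) U = (\<lambda>x\<in>U. x)" using U by (auto simp: subuniverse_def fun_eq_iff)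
  then show "(\<lambda>x\<in>U. x) \<in> homs (substruct B U) B"
    using homs_substruct_dom[OF homs_id[OF B] U] by simp
  show "separates_struct {\<lambda>x\<in>U. x} (substruct B U) B"
  proof (rule separates_structI)
    fix r a assume "a \<in> tuples (rar (substruct B U) r) (carr (substruct B U))"
      and "\<And>z. z \<in> {\<lambda>x\<in>U. x} \<Longrightarrow> compose {..<rar (substruct B U) r} z a \<in> rln B r"
    then show "a \<in> rln (substruct B U) r" using compose_id_tuple[of a "rar B r" U] by simp
  qed auto
qed

lemma opn_power_apply:
  "s \<in> S \<Longrightarrow> opn (power_struct P S) g a s = opn P g (\<lambda>i\<in>{..<oar P g}. a i s)"
  and rln_power_iff: "a \<in> rln (power_struct P S) r \<longleftrightarrow>
    a \<in> tuples (rar P r) (S \<rightarrow>\<^sub>E carr P) \<and> (\<forall>s\<in>S. (\<lambda>i\<in>{..<rar P r}. a i s) \<in> rln P r)"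
  by (auto simp: power_struct_def)

lemma compose_proj:
  assumes "a \<in> tuples n U" "s \<in> S"
  shows "compose {..<n} (\<lambda>x\<in>U. x s) a = (\<lambda>i\<in>{..<n}. a i s)"
  using assms by (auto simp: compose_def fun_eq_iff)

lemma projection_homs:
  assumes P: "is_struct P" and s: "s \<in> S"
  shows "(\<lambda>x\<in>S \<rightarrow>\<^sub>E carr P. x s) \<in> homs (power_struct P S) P"
proof (rule homsI)
  fix g a assume "g \<in> opsyms (sg (power_struct P S))"
    "a \<in> tuples (oar (power_struct P S) g) (carr (power_struct P S))"
  then show "(\<lambda>x\<in>S \<rightarrow>\<^sub>E carr P. x s) (opn (power_struct P S) g a) =
       opn P g (compose {..<oar (power_struct P S) g} (\<lambda>x\<in>S \<rightarrow>\<^sub>E carr P. x s) a)"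
    using opn_closed[OF is_struct_power[OF P], of g S a] compose_proj[of a "oar P g" "S \<rightarrow>\<^sub>E carr P" s S] s
    by (simp add: opn_power_apply)
next
  fix r a assume "r \<in> relsyms (sg (power_struct P S))" "a \<in> rln (power_struct P S) r"
  then show "compose {..<rar (power_struct P S) r} (\<lambda>x\<in>S \<rightarrow>\<^sub>E carr P. x s) a \<in> rln P r"
    using compose_proj[of a "rar P r" "S \<rightarrow>\<^sub>E carr P" s S] s by (simp add: rln_power_iff)
qed (use s in auto)

lemma separates_projections:
  "separates_struct ((\<lambda>s. \<lambda>x\<in>S \<rightarrow>\<^sub>E carr P. x s) ` S) (power_struct P S) P"
proof (rule separates_structI)
  fix x y assume x: "x \<in> carr (power_struct P S)" and y: "y \<in> carr (power_struct P S)"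
    and eq: "\<And>z. z \<in> (\<lambda>s. \<lambda>x\<in>S \<rightarrow>\<^sub>E carr P. x s) ` S \<Longrightarrow> z x = z y"
  have "x s = y s" if "s \<in> S" for s
    using eq[of "\<lambda>x\<in>S \<rightarrow>\<^sub>E carr P. x s"] that x y by simp
  then show "x = y" using x y by (intro PiE_ext[of x S "\<lambda>_. carr P" y]) auto
next
  fix r a assume a: "a \<in> tuples (rar (power_struct P S) r) (carr (power_struct P S))"
    and z: "\<And>z. z \<in> (\<lambda>s. \<lambda>x\<in>S \<rightarrow>\<^sub>E carr P. x s) ` S \<Longrightarrow> compose {..<rar (power_struct P S) r} z a \<in> rln P r"
  have "(\<lambda>i\<in>{..<rar P r}. a i s) \<in> rln P r" if "s \<in> S" for s
    using z[of "\<lambda>x\<in>S \<rightarrow>\<^sub>E carr P. x s"] that compose_proj[of a "rar P r" "S \<rightarrow>\<^sub>E carr P" s S] a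
    by simp
  then show "a \<in> rln (power_struct P S) r" using a by (simp add: rln_power_iff)
qed

lemma
  assumes P: "is_struct P" and U: "subuniverse U (power_struct P S)"
  shows projection_homs_sub: "s \<in> S \<Longrightarrow> (\<lambda>x\<in>U. x s) \<in> homs (substruct (power_struct P S) U) P"
    and separates_projections_sub:
      "separates_struct ((\<lambda>s. \<lambda>x\<in>U. x s) ` S) (substruct (power_struct P S) U) P"
proof -
  have US: "U \<subseteq> S \<rightarrow>\<^sub>E carr P" using U by (simp add: subuniverse_def)
  have eq: "restrict (\<lambda>x\<in>S \<rightarrow>\<^sub>E carr P. x s) U = (\<lambda>x\<in>U. x s)" for s
    using US by (auto simp: fun_eq_iff)
  show "(\<lambda>x\<in>U. x s) \<in> homs (substruct (power_struct P S) U) P" if "s \<in> S"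
    using homs_substruct_dom[OF projection_homs[OF P that] U] by (simp only: eq)
  show "separates_struct ((\<lambda>s. \<lambda>x\<in>U. x s) ` S) (substruct (power_struct P S) U) P"
  proof (rule separates_struct_comp[OF _ _ separates_projections])
    show "{\<lambda>x\<in>U. x} \<subseteq> homs (substruct (power_struct P S) U) (power_struct P S)"
      using inclusion_homs[OF is_struct_power[OF P] U] by blast
    show "separates_struct {\<lambda>x\<in>U. x} (substruct (power_struct P S) U) (power_struct P S)"
      using inclusion_homs[OF is_struct_power[OF P] U] by blast
    fix z w assume "z \<in> {\<lambda>x\<in>U. x}" and w: "w \<in> (\<lambda>s. \<lambda>x\<in>S \<rightarrow>\<^sub>E carr P. x s) ` S"
    then obtain s where s: "s \<in> S" "w = (\<lambda>x\<in>S \<rightarrow>\<^sub>E carr P. x s)" and z: "z = (\<lambda>x\<in>U. x)" by blast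
    have "compose (carr (substruct (power_struct P S) U)) w z = (\<lambda>x\<in>U. x s)"
      using US by (auto simp: s z compose_def fun_eq_iff)
    then show "compose (carr (substruct (power_struct P S) U)) w z \<in> (\<lambda>s. \<lambda>x\<in>U. x s) ` S"
      using s by blast
  qed
qed

section \<open>Maps into powers, and the class \<open>ISP\<close> described by separation\<close>

lemma compose_tupling:
  assumes "a \<in> tuples n A" "s \<in> S"
  shows "(\<lambda>i\<in>{..<n}. compose {..<n} (\<lambda>x\<in>A. \<lambda>s\<in>S. z s x) a i s) = compose {..<n} (z s) a"
  using assms by (auto simp: compose_def fun_eq_iff)

text \<open>The universal property of the power. Equality of signatures is a separate assumption
  because \<open>S\<close> may be empty, and then no \<open>z s\<close> provides it.\<close>

lemma tupling_homs:
  assumes A: "is_struct A" and z: "\<And>s. s \<in> S \<Longrightarrow> z s \<in> homs A P" and sg: "sg A = sg P"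
  shows "(\<lambda>a\<in>carr A. \<lambda>s\<in>S. z s a) \<in> homs A (power_struct P S)"
proof (rule homsI)
  have zA: "z s a \<in> carr P" if "s \<in> S" "a \<in> carr A" for s a
    using homs_Pi[OF z[OF that(1)]] that by blast
  then show e: "(\<lambda>a\<in>carr A. \<lambda>s\<in>S. z s a) \<in> carr A \<rightarrow>\<^sub>E carr (power_struct P S)" by auto
  show "sg A = sg (power_struct P S)" by (simp add: sg)
  fix g a assume g: "g \<in> opsyms (sg A)" and a: "a \<in> tuples (oar A g) (carr A)"
  have "(\<lambda>s\<in>S. z s (opn A g a)) =
      (\<lambda>s\<in>S. opn P g (\<lambda>i\<in>{..<oar A g}. compose {..<oar A g} (\<lambda>a\<in>carr A. \<lambda>s\<in>S. z s a) a i s))"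
    by (rule restrict_ext) (simp only: homs_opn[OF z g a] compose_tupling[OF a])
  then show "(\<lambda>a\<in>carr A. \<lambda>s\<in>S. z s a) (opn A g a) =
      opn (power_struct P S) g (compose {..<oar A g} (\<lambda>a\<in>carr A. \<lambda>s\<in>S. z s a) a)"
    using opn_closed[OF A g a] by (simp add: power_struct_def sg)
next
  have zA: "z s a \<in> carr P" if "s \<in> S" "a \<in> carr A" for s a
    using homs_Pi[OF z[OF that(1)]] that by blast
  fix r a assume r: "r \<in> relsyms (sg A)" and a: "a \<in> rln A r"
  have at: "a \<in> tuples (rar A r) (carr A)" by (rule rln_tuples[OF A r a])
  have "compose {..<rar A r} (\<lambda>a\<in>carr A. \<lambda>s\<in>S. z s a) a \<in> tuples (rar A r) (S \<rightarrow>\<^sub>E carr P)"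
    by (rule compose_in_tuples[OF _ at]) (use zA in auto)
  moreover have "(\<lambda>i\<in>{..<rar A r}. compose {..<rar A r} (\<lambda>a\<in>carr A. \<lambda>s\<in>S. z s a) a i s) \<in> rln P r"
    if "s \<in> S" for s
    using homs_rln[OF z[OF that] r a] compose_tupling[OF at that, of z] by simp
  ultimately show "compose {..<rar A r} (\<lambda>a\<in>carr A. \<lambda>s\<in>S. z s a) a \<in> rln (power_struct P S) r"
    by (simp add: rln_power_iff sg[symmetric])
qed

lemma separates_tupling:
  assumes s: "separates_struct (z ` S) A P" and sg: "sg A = sg P"
  shows "separates_struct {\<lambda>a\<in>carr A. \<lambda>s\<in>S. z s a} A (power_struct P S)"
proof (rule separates_structI)
  fix a b assume a: "a \<in> carr A" and b: "b \<in> carr A"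
    and eq: "\<And>e. e \<in> {\<lambda>a\<in>carr A. \<lambda>s\<in>S. z s a} \<Longrightarrow> e a = e b"
  have "(\<lambda>s\<in>S. z s a) = (\<lambda>s\<in>S. z s b)" using eq a b by simp
  then have "z s a = z s b" if "s \<in> S" for s using that by (metis restrict_apply')
  then show "a = b" by (intro separates_structD_points[OF s a b]) auto
next
  fix r a assume r: "r \<in> relsyms (sg A)" and a: "a \<in> tuples (rar A r) (carr A)"
    and e: "\<And>e. e \<in> {\<lambda>a\<in>carr A. \<lambda>s\<in>S. z s a} \<Longrightarrow> compose {..<rar A r} e a \<in> rln (power_struct P S) r"
  have "compose {..<rar A r} (z s) a \<in> rln P r" if "s \<in> S" for s
    using e[OF singletonI] that compose_tupling[OF a that, of z]
    unfolding rln_power_iff sg[symmetric] by metis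
  then show "a \<in> rln A r" by (intro separates_structD_rln[OF s r a]) auto
qed

lemma separates_homs_power:
  assumes A: "is_struct A" and P: "is_struct P" and e: "e \<in> homs A (power_struct P S)"
    and s: "separates_struct {e} A (power_struct P S)"
    and V: "\<And>s. s \<in> S \<Longrightarrow> compose (carr A) (\<lambda>x\<in>S \<rightarrow>\<^sub>E carr P. x s) e \<in> V"
  shows "separates_struct V A P"
  by (rule separates_struct_comp[OF _ s separates_projections]) (use e V in auto)

text \<open>An embedding into a power followed by the projections gives enough morphisms; conversely
  all morphisms are tupled at once. The index set \<open>homs A P\<close> used for this has exactly
  the type that the definition of \<open>ISP\<close> allows.\<close>

lemma ISP_iff:
  fixes P :: "('m, 'f, 'r) struct" and A :: "('a, 'f, 'r) struct"
  assumes P: "is_struct P"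
  shows "A \<in> ISP P \<longleftrightarrow>
    is_struct A \<and> carr A \<noteq> {} \<and> sg A = sg P \<and> separates_struct (homs A P) A P"
proof
  assume "A \<in> ISP P"
  then obtain S :: "('a \<Rightarrow> 'm) set" and e where A: "is_struct A" and em: "embedding A (power_struct P S) e"
    unfolding ISP_def by blast
  then have e: "e \<in> homs A (power_struct P S)" "separates_struct {e} A (power_struct P S)" "carr A \<noteq> {}"
    using embedding_iff[OF A, of "power_struct P S" e] by auto
  have "separates_struct (homs A P) A P"
    by (rule separates_homs_power[OF A P e(1,2)]) (rule homs_comp[OF A e(1) projection_homs[OF P]], assumption)
  then show "is_struct A \<and> carr A \<noteq> {} \<and> sg A = sg P \<and> separates_struct (homs A P) A P"
    using A e homs_sg[OF e(1)] by simp
next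
  assume "is_struct A \<and> carr A \<noteq> {} \<and> sg A = sg P \<and> separates_struct (homs A P) A P"
  then have A: "is_struct A" and ne: "carr A \<noteq> {}" and sg: "sg A = sg P"
    and s: "separates_struct (homs A P) A P" by blast+
  have "embedding A (power_struct P (homs A P)) (\<lambda>a\<in>carr A. \<lambda>x\<in>homs A P. x a)"
    using tupling_homs[OF A _ sg, of "homs A P" "\<lambda>x. x"] separates_tupling[OF _ sg, of "\<lambda>x. x" "homs A P"] s ne
    by (subst embedding_iff[OF A]) simp
  then show "A \<in> ISP P" unfolding ISP_def using A by blast
qed

section \<open>Compact structures and continuous morphisms\<close>

lemma chom_iff: "f \<in> chom X Y \<longleftrightarrow> f \<in> homs (fst X) (fst Y) \<and> continuous_map (snd X) (snd Y) f"
  by (simp add: chom_def)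

lemma chom_comp:
  assumes "is_struct (fst X)" and X: "topspace (snd X) = carr (fst X)" and f: "f \<in> chom X Y" and g: "g \<in> chom Y Z"
  shows "compose (carr (fst X)) g f \<in> chom X Z"
proof -
  have "continuous_map (snd X) (snd Z) (g \<circ> f)"
    using f g by (auto simp: chom_iff intro: continuous_map_compose)
  then have "continuous_map (snd X) (snd Z) (compose (carr (fst X)) g f)"
    by (rule continuous_map_eq) (simp add: X compose_def)
  then show ?thesis using assms homs_comp by (simp add: chom_iff) blast
qed

lemma separates_inj_on: "separates_struct {f} A B \<Longrightarrow> inj_on f (carr A)"
  by (rule inj_onI) (auto intro: separates_structD_points)

lemma iso_tstruct_iff:
  assumes X: "is_struct (fst X)" "topspace (snd X) = carr (fst X)" "compact_space (snd X)"
    and Y: "is_struct (fst Y)" "topspace (snd Y) = carr (fst Y)" "Hausdorff_space (snd Y)"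
  shows "iso_tstruct X Y f \<longleftrightarrow>
    f \<in> chom X Y \<and> separates_struct {f} (fst X) (fst Y) \<and> f ` carr (fst X) = carr (fst Y)"
proof
  assume "iso_tstruct X Y f"
  then show "f \<in> chom X Y \<and> separates_struct {f} (fst X) (fst Y) \<and> f ` carr (fst X) = carr (fst Y)"
    by (simp add: iso_tstruct_def iso_struct_iff[OF X(1) Y(1)] chom_iff homeomorphic_imp_continuous_map)
next
  assume R: "f \<in> chom X Y \<and> separates_struct {f} (fst X) (fst Y) \<and> f ` carr (fst X) = carr (fst Y)"
  then have "homeomorphic_map (snd X) (snd Y) f"
    using X Y by (intro continuous_imp_homeomorphic_map) (auto simp: chom_iff separates_inj_on)
  then show "iso_tstruct X Y f"
    using R by (simp add: iso_tstruct_def iso_struct_iff[OF X(1) Y(1)] chom_iff)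
qed

text \<open>A continuous image of a compact space in a Hausdorff space is closed, and a continuous
  injection between such spaces is a homeomorphism onto its image. So continuity is the only
  topological condition left.\<close>

lemma tembedding_iff:
  assumes X: "is_struct (fst X)" "topspace (snd X) = carr (fst X)" "compact_space (snd X)"
    and Y: "is_struct (fst Y)" "topspace (snd Y) = carr (fst Y)" "Hausdorff_space (snd Y)"
  shows "tembedding X Y f \<longleftrightarrow> f \<in> chom X Y \<and> separates_struct {f} (fst X) (fst Y)"
proof -
  have sub: "is_struct (fst (tsubstruct Y U)) \<and> topspace (snd (tsubstruct Y U)) = carr (fst (tsubstruct Y U))
      \<and> Hausdorff_space (snd (tsubstruct Y U))" if "subuniverse U (fst Y)" for U
    using that Y is_struct_substruct[OF that Y(1)]
    by (auto simp: tsubstruct_def subuniverse_def Hausdorff_space_subtopology)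
  show ?thesis
  proof
    assume "tembedding X Y f"
    then obtain U where U: "subuniverse U (fst Y)" and "iso_tstruct X (tsubstruct Y U) f"
      unfolding tembedding_def forms_closed_substruct_def by blast
    then have "iso_struct (fst X) (substruct (fst Y) U) f" "continuous_map (snd X) (subtopology (snd Y) U) f"
      by (simp_all add: iso_tstruct_def tsubstruct_def homeomorphic_imp_continuous_map)
    then show "f \<in> chom X Y \<and> separates_struct {f} (fst X) (fst Y)"
      using iso_substruct_imp[OF X(1) U] by (simp add: chom_iff continuous_map_in_subtopology)
  next
    assume f: "f \<in> chom X Y \<and> separates_struct {f} (fst X) (fst Y)"
    let ?U = "f ` carr (fst X)"
    have "compactin (snd Y) ?U"
      using f X image_compactin[of "snd X" "topspace (snd X)" "snd Y" f] by (simp add: chom_iff compact_space_def)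
    then have cl: "closedin (snd Y) ?U" by (rule compactin_imp_closedin[OF Y(3)])
    have i: "subuniverse ?U (fst Y)" "iso_struct (fst X) (substruct (fst Y) ?U) f"
      using iso_struct_image[OF X(1)] f by (auto simp: chom_iff)
    have "iso_tstruct X (tsubstruct Y ?U) f"
      unfolding iso_tstruct_def
    proof
      show "iso_struct (fst X) (fst (tsubstruct Y ?U)) f" using i by (simp add: tsubstruct_def)
      have "continuous_map (snd X) (subtopology (snd Y) ?U) f"
        using f by (auto simp: chom_iff continuous_map_in_subtopology X(2))
      moreover have "f ` topspace (snd X) = topspace (subtopology (snd Y) ?U)"
        using closedin_subset[OF cl] by (auto simp: X(2))
      moreover have "inj_on f (topspace (snd X))"
        using separates_inj_on f X(2) by metis
      ultimately have "homeomorphic_map (snd X) (subtopology (snd Y) ?U) f"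
        by (rule continuous_imp_homeomorphic_map[OF _ X(3) Hausdorff_space_subtopology[OF Y(3)]])
      then show "homeomorphic_map (snd X) (snd (tsubstruct Y ?U)) f" by (simp add: tsubstruct_def)
    qed
    then show "tembedding X Y f"
      unfolding tembedding_def forms_closed_substruct_def using i cl by blast
  qed
qed

lemma topological_structD:
  assumes "topological_struct Q T"
  shows "is_struct Q" "total_struct Q" "topspace T = carr Q" "compact_space T" "Hausdorff_space T"
    "g \<in> opsyms (sg Q) \<Longrightarrow> continuous_map (tpower {..<oar Q g} T) T (opn Q g)"
    "r \<in> relsyms (sg Q) \<Longrightarrow> closedin (tpower {..<rar Q r} T) (rln Q r)"
  using assms by (auto simp: topological_struct_def total_struct_def)

lemma tpower_topological:
  assumes "topological_struct Q T"
  shows "topspace (tpower S T) = S \<rightarrow>\<^sub>E carr Q" "compact_space (tpower S T)" "Hausdorff_space (tpower S T)"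
  using topological_structD[OF assms]
  by (auto simp: compact_space_product_topology Hausdorff_space_product_topology)

lemma continuous_map_tupling:
  assumes X: "topspace X = A" and z: "\<And>s. s \<in> S \<Longrightarrow> continuous_map X T (z s)"
  shows "continuous_map X (tpower S T) (\<lambda>a\<in>A. \<lambda>s\<in>S. z s a)"
  unfolding continuous_map_componentwise
proof (intro conjI ballI)
  show "(\<lambda>a\<in>A. \<lambda>s\<in>S. z s a) ` topspace X \<subseteq> extensional S" by (auto simp: X)
  show "continuous_map X T (\<lambda>a. (\<lambda>a\<in>A. \<lambda>s\<in>S. z s a) a s)" if "s \<in> S" for s
    by (rule continuous_map_eq[OF z[OF that]]) (use that X in simp)
qed

text \<open>Projections and tupling work as for \<open>ISP_iff\<close>. Non-emptiness of
  \<open>chom\<close> encodes that the index set of the power is non-empty, and it also fixes the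
  signature.\<close>

lemma IScPp_iff:
  fixes Q :: "('m, 'f, 'r) struct" and X :: "('x, 'f, 'r) tstruct"
  assumes Q: "topological_struct Q T"
  shows "X \<in> IScPp (Q, T) \<longleftrightarrow>
    is_struct (fst X) \<and> topspace (snd X) = carr (fst X) \<and> compact_space (snd X) \<and>
    chom X (Q, T) \<noteq> {} \<and> separates_struct (chom X (Q, T)) (fst X) Q"
proof
  note Qs = topological_structD[OF Q] and Qt = tpower_topological[OF Q]
  assume "X \<in> IScPp (Q, T)"
  then obtain S :: "('x \<Rightarrow> 'm) set" and e where X: "is_struct (fst X)" "topspace (snd X) = carr (fst X)"
    and S: "S \<noteq> {}" and em: "tembedding X (tpower_struct (Q, T) S) e"
    unfolding IScPp_def by blast
  \<comment> \<open>Compactness comes first, since \<open>tembedding_iff\<close> presupposes it: it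
    is read off from the homeomorphism onto a closed subset of a compact power.\<close>
  then obtain U where U: "closedin (tpower S T) U" and "iso_tstruct X (tsubstruct (tpower_struct (Q, T) S) U) e"
    unfolding tembedding_def forms_closed_substruct_def by (auto simp: tpower_struct_def)
  then have "homeomorphic_map (snd X) (subtopology (tpower S T) U) e"
    by (simp add: iso_tstruct_def tsubstruct_def tpower_struct_def)
  from homeomorphic_compact_space[OF homeomorphic_map_imp_homeomorphic_space[OF this]]
  have comp: "compact_space (snd X)"
    using compact_space_subtopology[OF closedin_compact_space[OF Qt(2) U]] by simp
  have e: "e \<in> chom X (power_struct Q S, tpower S T)" "separates_struct {e} (fst X) (power_struct Q S)"
    using em tembedding_iff[OF X comp, of "(power_struct Q S, tpower S T)" e]
      is_struct_power[OF Qs(1), of S] Qt[of S] Qs(3) by (simp_all add: tpower_struct_def)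
  have p: "compose (carr (fst X)) (\<lambda>x\<in>S \<rightarrow>\<^sub>E carr Q. x s) e \<in> chom X (Q, T)" if "s \<in> S" for s
  proof (rule chom_comp[OF X e(1)])
    have "continuous_map (tpower S T) T (\<lambda>x\<in>S \<rightarrow>\<^sub>E carr Q. x s)"
      by (rule continuous_map_eq[OF continuous_map_product_projection[OF that]]) (use Qs(3) in simp)
    then show "(\<lambda>x\<in>S \<rightarrow>\<^sub>E carr Q. x s) \<in> chom (power_struct Q S, tpower S T) (Q, T)"
      using projection_homs[OF Qs(1) that] by (simp add: chom_iff)
  qed
  have "separates_struct (chom X (Q, T)) (fst X) Q"
    by (rule separates_homs_power[OF X(1) Qs(1) _ e(2) p]) (use e in \<open>simp add: chom_iff\<close>)
  then show "is_struct (fst X) \<and> topspace (snd X) = carr (fst X) \<and> compact_space (snd X) \<and>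
    chom X (Q, T) \<noteq> {} \<and> separates_struct (chom X (Q, T)) (fst X) Q"
    using X comp S p by blast
next
  note Qs = topological_structD[OF Q] and Qt = tpower_topological[OF Q]
  assume R: "is_struct (fst X) \<and> topspace (snd X) = carr (fst X) \<and> compact_space (snd X) \<and>
    chom X (Q, T) \<noteq> {} \<and> separates_struct (chom X (Q, T)) (fst X) Q"
  then have X: "is_struct (fst X)" "topspace (snd X) = carr (fst X)" "compact_space (snd X)" by blast+
  let ?S = "chom X (Q, T)"
  let ?e = "\<lambda>a\<in>carr (fst X). \<lambda>x\<in>?S. x a"
  have sg: "sg (fst X) = sg Q" using R homs_sg by (fastforce simp: chom_iff)
  have "?e \<in> homs (fst X) (power_struct Q ?S)"
    by (rule tupling_homs[OF X(1) _ sg]) (simp add: chom_iff)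
  moreover have "continuous_map (snd X) (tpower ?S T) ?e"
    using X(2) by (intro continuous_map_tupling) (auto simp: chom_iff)
  moreover have "separates_struct {?e} (fst X) (power_struct Q ?S)"
    by (rule separates_tupling[OF _ sg, of "\<lambda>x. x"]) (use R in simp)
  ultimately have "tembedding X (tpower_struct (Q, T) ?S) ?e"
    using tembedding_iff[OF X, of "(power_struct Q ?S, tpower ?S T)" ?e]
      is_struct_power[OF Qs(1), of ?S] Qt[of ?S] Qs(3) by (simp add: tpower_struct_def chom_iff)
  then show "X \<in> IScPp (Q, T)" unfolding IScPp_def using R by blast
qed

lemma IScPp_Hausdorff:
  assumes Q: "topological_struct Q T" and X: "X \<in> IScPp (Q, T)"
  shows "Hausdorff_space (snd X)"
proof -
  have X': "topspace (snd X) = carr (fst X)" "separates_struct (chom X (Q, T)) (fst X) Q"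
    using X unfolding IScPp_iff[OF Q] by blast+
  show ?thesis
    unfolding Hausdorff_space_def
  proof (intro allI impI)
    fix x y assume xy: "x \<in> topspace (snd X) \<and> y \<in> topspace (snd X) \<and> x \<noteq> y"
    then obtain f where f: "continuous_map (snd X) T f" and ne: "f x \<noteq> f y"
      using separates_structD_points[OF X'(2), of x y] X'(1) by (auto simp: chom_iff)
    \<comment> \<open>Disjoint neighbourhoods of the two values in the Hausdorff generator pull back
      along \<open>f\<close>.\<close>
    have "f x \<in> topspace T" "f y \<in> topspace T" using f xy by (auto simp: continuous_map_def)
    then obtain U V where UV: "openin T U" "openin T V" "f x \<in> U" "f y \<in> V" "disjnt U V"
      using topological_structD(5)[OF Q] ne unfolding Hausdorff_space_def by blast
    show "\<exists>U V. openin (snd X) U \<and> openin (snd X) V \<and> x \<in> U \<and> y \<in> V \<and> disjnt U V"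
      using openin_continuous_map_preimage[OF f UV(1)] openin_continuous_map_preimage[OF f UV(2)] UV xy
      by (intro exI[of _ "{x \<in> topspace (snd X). f x \<in> U}"] exI[of _ "{x \<in> topspace (snd X). f x \<in> V}"])
        (auto simp: disjnt_iff)
  qed
qed

lemma ISP_D:
  assumes "A \<in> ISP P" "is_struct P"
  shows "is_struct A" "carr A \<noteq> {}" "sg A = sg P" "separates_struct (homs A P) A P"
  using assms(1) unfolding ISP_iff[OF assms(2)] by blast+

lemma IScPp_D:
  assumes X: "X \<in> IScPp (Q, T)" and Q: "topological_struct Q T"
  shows "is_struct (fst X)" "topspace (snd X) = carr (fst X)" "compact_space (snd X)"
    "chom X (Q, T) \<noteq> {}" "separates_struct (chom X (Q, T)) (fst X) Q" "sg (fst X) = sg Q"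
    "Hausdorff_space (snd X)"
proof -
  show *: "is_struct (fst X)" "topspace (snd X) = carr (fst X)" "compact_space (snd X)"
    "chom X (Q, T) \<noteq> {}" "separates_struct (chom X (Q, T)) (fst X) Q"
    using X unfolding IScPp_iff[OF Q] by blast+
  then show "sg (fst X) = sg Q" using homs_sg by (fastforce simp: chom_iff)
  show "Hausdorff_space (snd X)" by (rule IScPp_Hausdorff[OF Q X])
qed

text \<open>Smaller relations in the target are easier to escape. So a map that separates into a
  power also separates into the substructures of that power, whose relations are cut down.\<close>

lemma separates_struct_codom:
  "separates_struct Z A C \<Longrightarrow> (\<And>r. rln B r \<subseteq> rln C r) \<Longrightarrow> separates_struct Z A B"
  unfolding separates_struct_def by blast

lemma iso_struct_inverse:
  assumes "iso_struct A B f"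
  obtains q where "q \<in> homs B A" "\<forall>a\<in>carr A. q (f a) = a"
proof
  show "restrict (inv_into (carr A) f) (carr B) \<in> homs B A" using assms by (simp add: iso_struct_def)
  show "\<forall>a\<in>carr A. restrict (inv_into (carr A) f) (carr B) (f a) = a"
    using assms by (auto simp: iso_struct_def bij_betw_def)
qed

lemma iso_tstruct_inverse:
  assumes iso: "iso_tstruct X Y f"
    and X: "topspace (snd X) = carr (fst X)" and Y: "topspace (snd Y) = carr (fst Y)"
  obtains q where "q \<in> chom Y X" "\<forall>a\<in>carr (fst X). q (f a) = a"
proof -
  obtain q where q: "q \<in> homs (fst Y) (fst X)" "\<forall>a\<in>carr (fst X). q (f a) = a"
    using iso iso_struct_inverse by (metis iso_tstruct_def)
  obtain g where g: "homeomorphic_maps (snd X) (snd Y) f g"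
    using iso by (auto simp: iso_tstruct_def homeomorphic_map_maps)
  \<comment> \<open>The algebraic inverse \<open>q\<close> and the topological inverse
    \<open>g\<close> are obtained independently; they agree on the carrier, which makes
    \<open>q\<close> continuous.\<close>
  have "g y = q y" if "y \<in> topspace (snd Y)" for y
  proof -
    have "g y \<in> carr (fst X)" "f (g y) = y"
      using g that X by (auto simp: homeomorphic_maps_def continuous_map_def)
    then show ?thesis using bspec[OF q(2), of "g y"] by simp
  qed
  then have "continuous_map (snd Y) (snd X) q"
    using g continuous_map_eq[of "snd Y" "snd X" g q] by (auto simp: homeomorphic_maps_def)
  then show ?thesis using q that by (simp add: chom_iff)
qed

lemma substruct_power_ISP:
  assumes P: "is_struct P" and ne: "U \<noteq> {}" and U: "subuniverse U (power_struct P S)"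
  shows "substruct (power_struct P S) U \<in> ISP P"
  unfolding ISP_iff[OF P]
proof (intro conjI)
  show "is_struct (substruct (power_struct P S) U)"
    by (rule is_struct_substruct[OF U is_struct_power[OF P]])
  show "separates_struct (homs (substruct (power_struct P S) U) P) (substruct (power_struct P S) U) P"
    by (rule separates_struct_mono[OF separates_projections_sub[OF P U]])
      (use projection_homs_sub[OF P U] in blast)
qed (use ne in auto)

lemma tsubstruct_tpower_simps [simp]:
  "fst (tsubstruct (tpower_struct (Q, T) S) U) = substruct (power_struct Q S) U"
  "snd (tsubstruct (tpower_struct (Q, T) S) U) = subtopology (tpower S T) U"
  by (simp_all add: tsubstruct_def tpower_struct_def)

lemma
  assumes Q: "topological_struct Q T" and U: "subuniverse U (power_struct Q S)"
  shows projection_chom: "s \<in> S \<Longrightarrow> (\<lambda>x\<in>U. x s) \<in> chom (tsubstruct (tpower_struct (Q, T) S) U) (Q, T)"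
    and closed_substruct_IScPp: "S \<noteq> {} \<Longrightarrow> closedin (tpower S T) U \<Longrightarrow>
      tsubstruct (tpower_struct (Q, T) S) U \<in> IScPp (Q, T)"
proof -
  note Qs = topological_structD[OF Q] and Qt = tpower_topological[OF Q]
  show p: "(\<lambda>x\<in>U. x s) \<in> chom (tsubstruct (tpower_struct (Q, T) S) U) (Q, T)" if "s \<in> S" for s
  proof -
    have "continuous_map (subtopology (tpower S T) U) T (\<lambda>x\<in>U. x s)"
      by (rule continuous_map_eq[OF continuous_map_from_subtopology[OF continuous_map_product_projection[OF that]]])
        auto
    then show ?thesis using projection_homs_sub[OF Qs(1) U that] by (simp add: chom_iff)
  qed
  assume ne: "S \<noteq> {}" and cl: "closedin (tpower S T) U"
  let ?X = "tsubstruct (tpower_struct (Q, T) S) U"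
  show "?X \<in> IScPp (Q, T)"
    unfolding IScPp_iff[OF Q]
  proof (intro conjI)
    show "is_struct (fst ?X)" using is_struct_substruct[OF U is_struct_power[OF Qs(1)]] by simp
    show "topspace (snd ?X) = carr (fst ?X)" using closedin_subset[OF cl] by auto
    show "compact_space (snd ?X)"
      using compact_space_subtopology[OF closedin_compact_space[OF Qt(2) cl]] by simp
    show "chom ?X (Q, T) \<noteq> {}" using p ne by blast
    show "separates_struct (chom ?X (Q, T)) (fst ?X) Q"
      using separates_struct_mono[OF separates_projections_sub[OF Qs(1) U]] p by simp blast
  qed
qed

section \<open>Dual pairs\<close>

text \<open>Compatibility of a symbol of \<open>P\<close> with a symbol of \<open>Q\<close> concerns
  a matrix of elements, one symbol acting along the rows and the other along the columns.
  Transposition passes between the two readings.\<close>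

lemma transpose_tuples:
  assumes "a \<in> tuples n (tuples m C)"
  shows "(\<lambda>i\<in>{..<m}. \<lambda>j\<in>{..<n}. a j i) \<in> tuples m (tuples n C)"
    and "j < n \<Longrightarrow> (\<lambda>i\<in>{..<m}. (\<lambda>i\<in>{..<m}. \<lambda>j\<in>{..<n}. a j i) i j) = a j"
proof -
  have aj: "a j \<in> tuples m C" if "j < n" for j using assms that by (rule tuple_nth)
  show "(\<lambda>i\<in>{..<m}. \<lambda>j\<in>{..<n}. a j i) \<in> tuples m (tuples n C)"
    using tuple_nth[OF aj] by auto
  show "(\<lambda>i\<in>{..<m}. (\<lambda>i\<in>{..<m}. \<lambda>j\<in>{..<n}. a j i) i j) = a j" if "j < n"
  proof
    fix i show "(\<lambda>i\<in>{..<m}. (\<lambda>i\<in>{..<m}. \<lambda>j\<in>{..<n}. a j i) i j) i = a j i"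
      using that PiE_arb[OF aj[OF that], of i] by (cases "i < m") auto
  qed
qed

text \<open>Requiring both structures to be topological over the same \<open>T\<close> makes the
  setting symmetric in \<open>P\<close> and \<open>Q\<close>, so that facts about morphisms into
  \<open>P\<close> can be reused for morphisms into \<open>Q\<close>.\<close>

locale dual_pair =
  fixes P :: "('m, 'f1, 'r1) struct" and Q :: "('m, 'f2, 'r2) struct" and T :: "'m topology"
  assumes P: "topological_struct P T" and Q: "topological_struct Q T" and ego: "alter_ego (Q, T) P"
begin

lemma is_struct_P: "is_struct P" and is_struct_Q: "is_struct Q"
  using topological_structD(1)[OF P] topological_structD(1)[OF Q] by blast+

lemma carr_eq: "carr Q = carr P"
  using ego by (simp add: alter_ego_def)

lemma opn_hom:
  "g \<in> opsyms (sg Q) \<Longrightarrow> restrict (opn Q g) (tuples (oar Q g) (carr P)) \<in> homs (power_struct P {..<oar Q g}) P"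
  and rln_substruct: "r \<in> relsyms (sg Q) \<Longrightarrow> subuniverse (rln Q r) (power_struct P {..<rar Q r})"
  using ego by (auto simp: alter_ego_def forms_substruct_def)

lemma compose_transpose:
  assumes a: "a \<in> tuples n (tuples m (carr P))"
  shows "compose {..<n} (restrict h (tuples m (carr P))) a = (\<lambda>j\<in>{..<n}. h (a j))"
  using tuple_nth[OF a] by (auto simp: compose_def fun_eq_iff)

text \<open>Operations and relations of \<open>Q\<close> are compatible with those of
  \<open>P\<close> exactly when the converse holds, by transposing matrices; the topological
  conditions hold because both structures are topological.\<close>

lemma swap: "dual_pair Q P T"
proof
  show "topological_struct Q T" "topological_struct P T" by (fact Q P)+
  show "alter_ego (P, T) Q"
    unfolding alter_ego_def fst_conv snd_conv
  proof (intro conjI ballI)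
    show "carr P = carr Q" by (simp add: carr_eq)
    show "closedin (tpower {..<rar Q r} T) (rln Q r)" if "r \<in> relsyms (sg Q)" for r
      by (rule topological_structD(7)[OF Q that])
    show "continuous_map (tpower {..<oar Q g} T) T (opn Q g)" if "g \<in> opsyms (sg Q)" for g
      by (rule topological_structD(6)[OF Q that])
  next
    fix r assume r: "r \<in> relsyms (sg P)"
    let ?m = "rar P r"
    show "forms_substruct (rln P r) (power_struct Q {..<?m})"
      unfolding forms_substruct_def subuniverse_def
    proof (intro conjI ballI)
      show "rln P r \<noteq> {}" using topological_structD(2)[OF P] r by (simp add: total_struct_def)
      show rt: "rln P r \<subseteq> carr (power_struct Q {..<?m})"
        using rln_tuples[OF is_struct_P r] by (auto simp: carr_eq)
      fix g a assume "g \<in> opsyms (sg (power_struct Q {..<?m}))"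
        and "a \<in> tuples (oar (power_struct Q {..<?m}) g) (rln P r)"
      then have g: "g \<in> opsyms (sg Q)" and a: "a \<in> tuples (oar Q g) (rln P r)" by simp_all
      let ?n = "oar Q g"
      have at: "a \<in> tuples ?n (tuples ?m (carr P))" using a rt by (auto simp: carr_eq)
      \<comment> \<open>Every row of \<open>a\<close> lies in \<open>rln P r\<close>. Read by
        columns, the matrix is a tuple in the relation \<open>r\<close> of a power of
        \<open>P\<close>, and \<open>opn Q g\<close> preserves this relation, being a homomorphism
        from that power.\<close>
      let ?b = "\<lambda>i\<in>{..<?m}. \<lambda>j\<in>{..<?n}. a j i"
      note tr = transpose_tuples[OF at]
      have "?b \<in> rln (power_struct P {..<?n}) r"
        using tr(1) tr(2) tuple_nth[OF a] unfolding rln_power_iff by (metis lessThan_iff)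
      from homs_rln[OF opn_hom[OF g] _ this]
      have "compose {..<?m} (restrict (opn Q g) (tuples ?n (carr P))) ?b \<in> rln P r"
        using r by simp
      moreover have "compose {..<?m} (restrict (opn Q g) (tuples ?n (carr P))) ?b = opn (power_struct Q {..<?m}) g a"
        unfolding compose_transpose[OF tr(1)] by (auto simp: power_struct_def fun_eq_iff)
      ultimately show "opn (power_struct Q {..<?m}) g a \<in> rln P r" by simp
    qed
  next
    fix f assume f: "f \<in> opsyms (sg P)"
    let ?m = "oar P f"
    let ?F = "restrict (opn P f) (tuples ?m (carr Q))"
    show "?F \<in> homs (power_struct Q {..<?m}) Q"
    proof (rule homsI)
      show "?F \<in> carr (power_struct Q {..<?m}) \<rightarrow>\<^sub>E carr Q"
        using opn_closed[OF is_struct_P f] by (auto simp: carr_eq)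
      fix g a assume "g \<in> opsyms (sg (power_struct Q {..<?m}))"
        and "a \<in> tuples (oar (power_struct Q {..<?m}) g) (carr (power_struct Q {..<?m}))"
      then have g: "g \<in> opsyms (sg Q)" and a: "a \<in> tuples (oar Q g) (tuples ?m (carr P))"
        by (simp_all add: carr_eq)
      let ?n = "oar Q g"
      let ?b = "\<lambda>i\<in>{..<?m}. \<lambda>j\<in>{..<?n}. a j i"
      note tr = transpose_tuples[OF a]
      \<comment> \<open>\<open>f\<close> on the power of \<open>P\<close> acts on the transposed
        matrix row by row of \<open>a\<close>; the homomorphism property of \<open>opn Q g\<close>
        then exchanges the order in which \<open>f\<close> and \<open>g\<close> are applied.\<close>
      have op: "opn (power_struct P {..<?n}) f ?b = (\<lambda>j\<in>{..<?n}. opn P f (a j))"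
        unfolding power_struct_def struct.simps by (rule restrict_ext) (simp only: tr(2) lessThan_iff)
      have aj: "opn P f (a j) \<in> carr P" if "j < ?n" for j
        by (rule opn_closed[OF is_struct_P f tuple_nth[OF a that]])
      have "opn Q g (\<lambda>j\<in>{..<?n}. opn P f (a j)) = opn P f (compose {..<?m} (restrict (opn Q g) (tuples ?n (carr P))) ?b)"
        using homs_opn[OF opn_hom[OF g], of f ?b] f tr(1) op aj by simp
      also have "compose {..<?m} (restrict (opn Q g) (tuples ?n (carr P))) ?b = opn (power_struct Q {..<?m}) g a"
        unfolding compose_transpose[OF tr(1)] by (auto simp: power_struct_def fun_eq_iff)
      finally have "opn P f (opn (power_struct Q {..<?m}) g a) = opn Q g (\<lambda>j\<in>{..<?n}. opn P f (a j))" ..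
      moreover have "opn (power_struct Q {..<?m}) g a \<in> tuples ?m (carr Q)"
        using opn_closed[OF is_struct_power[OF is_struct_Q], of g "{..<?m}" a] g a by (simp add: carr_eq)
      ultimately show "?F (opn (power_struct Q {..<?m}) g a) =
          opn Q g (compose {..<oar (power_struct Q {..<?m}) g} ?F a)"
        using compose_transpose[OF a, of "opn P f"] by (simp add: carr_eq)
    next
      fix r a assume r': "r \<in> relsyms (sg (power_struct Q {..<?m}))" and a: "a \<in> rln (power_struct Q {..<?m}) r"
      then have r: "r \<in> relsyms (sg Q)" by simp
      let ?n = "rar Q r"
      have at: "a \<in> tuples ?n (tuples ?m (carr P))" and ar: "\<And>i. i < ?m \<Longrightarrow> (\<lambda>j\<in>{..<?n}. a j i) \<in> rln Q r"
        using a by (simp_all add: rln_power_iff carr_eq)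
      let ?b = "\<lambda>i\<in>{..<?m}. \<lambda>j\<in>{..<?n}. a j i"
      note tr = transpose_tuples[OF at]
      have op: "opn (power_struct P {..<?n}) f ?b = (\<lambda>j\<in>{..<?n}. opn P f (a j))"
        unfolding power_struct_def struct.simps by (rule restrict_ext) (simp only: tr(2) lessThan_iff)
      \<comment> \<open>The columns of \<open>a\<close> belong to \<open>rln Q r\<close>, which is
        closed under \<open>f\<close> because it is a subuniverse of a power of
        \<open>P\<close>.\<close>
      have "?b \<in> tuples ?m (rln Q r)" using ar by auto
      then have "opn (power_struct P {..<?n}) f ?b \<in> rln Q r"
        using rln_substruct[OF r] f by (simp add: subuniverse_def)
      then show "compose {..<rar (power_struct Q {..<?m}) r} ?F a \<in> rln Q r"
        using compose_transpose[OF at, of "opn P f"] op by (simp add: carr_eq)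
    qed simp
  qed
qed

text \<open>Applying an operation of \<open>Q\<close> pointwise to morphisms is tupling followed by
  that operation, which is itself a homomorphism from a power of \<open>P\<close>.\<close>

lemma subuniverse_homs:
  assumes A: "is_struct A" and sg: "sg A = sg P"
  shows "subuniverse (homs A P) (power_struct Q (carr A))"
  unfolding subuniverse_def
proof (intro conjI ballI)
  show "homs A P \<subseteq> carr (power_struct Q (carr A))" using homs_PiE by (force simp: carr_eq)
  fix g x assume "g \<in> opsyms (sg (power_struct Q (carr A)))"
    and "x \<in> tuples (oar (power_struct Q (carr A)) g) (homs A P)"
  then have g: "g \<in> opsyms (sg Q)" and x: "x \<in> tuples (oar Q g) (homs A P)" by simp_all
  let ?n = "oar Q g"
  have xh: "x i \<in> homs A P" if "i \<in> {..<?n}" for i using tuple_nth[OF x] that by simp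
  have t: "(\<lambda>a\<in>carr A. \<lambda>i\<in>{..<?n}. x i a) \<in> homs A (power_struct P {..<?n})"
    by (rule tupling_homs[OF A xh sg])
  have "(\<lambda>i\<in>{..<?n}. x i a) \<in> tuples ?n (carr P)" if "a \<in> carr A" for a
    using homs_Pi[OF xh] that by auto
  then have "compose (carr A) (restrict (opn Q g) (tuples ?n (carr P))) (\<lambda>a\<in>carr A. \<lambda>i\<in>{..<?n}. x i a) =
      opn (power_struct Q (carr A)) g x"
    unfolding compose_def power_struct_def struct.simps by (intro restrict_ext) (simp only: restrict_apply' if_True)
  then show "opn (power_struct Q (carr A)) g x \<in> homs A P"
    using homs_comp[OF A t opn_hom[OF g]] by simp
qed

text \<open>Each single instance of preservation is a closed condition on \<open>x\<close>: for an
  operation two continuous maps into a Hausdorff space agree, for a relation a closed set is pulled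
  back. The morphisms are the intersection of these.\<close>

lemma closedin_homs:
  assumes A: "is_struct A" and sg: "sg A = sg P"
  shows "closedin (tpower (carr A) T) (homs A P)"
proof -
  let ?X = "tpower (carr A) T"
  have top: "topspace ?X = carr A \<rightarrow>\<^sub>E carr P" by (rule tpower_topological(1)[OF P])
  have ev: "continuous_map ?X T (\<lambda>x. x a)" if "a \<in> carr A" for a
    by (rule continuous_map_product_projection[OF that])
  have tup: "continuous_map ?X (tpower {..<n} T) (\<lambda>x. compose {..<n} x a)"
    if a: "a \<in> tuples n (carr A)" for n a
    unfolding continuous_map_componentwise
    using ev tuple_nth[OF a] by (auto simp: compose_def)
  have 1: "closedin ?X {x \<in> topspace ?X. x (opn A g a) = opn P g (compose {..<oar A g} x a)}"
    if "g \<in> opsyms (sg A)" "a \<in> tuples (oar A g) (carr A)" for g a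
  proof (rule closedin_continuous_maps_eq[OF topological_structD(5)[OF P] ev[OF opn_closed[OF A that]]])
    show "continuous_map ?X T (\<lambda>x. opn P g (compose {..<oar A g} x a))"
      using continuous_map_compose[OF tup[OF that(2)], of T "opn P g"] topological_structD(6)[OF P, of g] that sg
      by (simp add: o_def)
  qed
  have 2: "closedin ?X {x \<in> topspace ?X. compose {..<rar A r} x a \<in> rln P r}"
    if "r \<in> relsyms (sg A)" "a \<in> rln A r" for r a
    by (rule closedin_continuous_map_preimage[OF tup[OF rln_tuples[OF A that]]])
      (use topological_structD(7)[OF P, of r] that sg in simp)
  \<comment> \<open>The whole space is included so that the family is non-empty even for a signature
    without symbols.\<close>
  let ?F = "{topspace ?X} \<union>
     {{x \<in> topspace ?X. x (opn A g a) = opn P g (compose {..<oar A g} x a)} | g a.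
        g \<in> opsyms (sg A) \<and> a \<in> tuples (oar A g) (carr A)} \<union>
     {{x \<in> topspace ?X. compose {..<rar A r} x a \<in> rln P r} | r a. r \<in> relsyms (sg A) \<and> a \<in> rln A r}"
  have "homs A P = \<Inter>?F"
  proof (intro subset_antisym subsetI)
    fix x assume x: "x \<in> homs A P"
    show "x \<in> \<Inter>?F"
      using homs_PiE[OF x] homs_opn[OF x] homs_rln[OF x] unfolding top by blast
  next
    fix x assume x: "x \<in> \<Inter>?F"
    show "x \<in> homs A P"
    proof (rule homsI[OF _ sg])
      show "x \<in> carr A \<rightarrow>\<^sub>E carr P" using x top by blast
      show "x (opn A g a) = opn P g (compose {..<oar A g} x a)"
        if "g \<in> opsyms (sg A)" "a \<in> tuples (oar A g) (carr A)" for g a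
      proof -
        have "x \<in> {x \<in> topspace ?X. x (opn A g a) = opn P g (compose {..<oar A g} x a)}"
          by (rule InterD[OF x]) (rule UnI1, rule UnI2, rule CollectI, rule exI[of _ g], rule exI[of _ a], intro conjI refl that)
        then show ?thesis by simp
      qed
      show "compose {..<rar A r} x a \<in> rln P r" if "r \<in> relsyms (sg A)" "a \<in> rln A r" for r a
      proof -
        have "x \<in> {x \<in> topspace ?X. compose {..<rar A r} x a \<in> rln P r}"
          by (rule InterD[OF x]) (rule UnI2, rule CollectI, rule exI[of _ r], rule exI[of _ a], intro conjI refl that)
        then show ?thesis by simp
      qed
    qed
  qed
  moreover have "closedin ?X (\<Inter>?F)"
    by (rule closedin_Inter) (use 1 2 closedin_topspace[of ?X] in auto)
  ultimately show ?thesis by simp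
qed

text \<open>Algebraically this is \<open>subuniverse_homs\<close> with \<open>P\<close> and
  \<open>Q\<close> exchanged; continuity survives because the operations of \<open>P\<close> are
  continuous.\<close>

lemma subuniverse_chom:
  assumes X: "is_struct (fst X)" "topspace (snd X) = carr (fst X)" and sg: "sg (fst X) = sg Q"
  shows "subuniverse (chom X (Q, T)) (power_struct P (carr (fst X)))"
  unfolding subuniverse_def
proof (intro conjI ballI)
  interpret sw: dual_pair Q P T by (rule swap)
  note sub = sw.subuniverse_homs[OF X(1) sg]
  show "chom X (Q, T) \<subseteq> carr (power_struct P (carr (fst X)))"
    using sub by (auto simp: subuniverse_def chom_iff)
  fix f \<alpha> assume "f \<in> opsyms (sg (power_struct P (carr (fst X))))"
    and "\<alpha> \<in> tuples (oar (power_struct P (carr (fst X))) f) (chom X (Q, T))"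
  then have f: "f \<in> opsyms (sg P)" and \<alpha>: "\<alpha> \<in> tuples (oar P f) (chom X (Q, T))" by simp_all
  have \<alpha>i: "\<alpha> i \<in> homs (fst X) Q" "continuous_map (snd X) T (\<alpha> i)" if "i \<in> {..<oar P f}" for i
    using tuple_nth[OF \<alpha>, of i] that by (simp_all add: chom_iff)
  then have "\<alpha> \<in> tuples (oar P f) (homs (fst X) Q)" using \<alpha> by (auto simp: PiE_iff)
  then have 1: "opn (power_struct P (carr (fst X))) f \<alpha> \<in> homs (fst X) Q"
    using sub f by (simp add: subuniverse_def)
  have "continuous_map (snd X) T (opn P f \<circ> (\<lambda>a\<in>carr (fst X). \<lambda>i\<in>{..<oar P f}. \<alpha> i a))"
    by (rule continuous_map_compose[OF continuous_map_tupling[OF X(2) \<alpha>i(2)] topological_structD(6)[OF P f]])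
  then have "continuous_map (snd X) T (opn (power_struct P (carr (fst X))) f \<alpha>)"
    by (rule continuous_map_eq) (simp add: X(2) power_struct_def)
  with 1 show "opn (power_struct P (carr (fst X))) f \<alpha> \<in> chom X (Q, T)" by (simp add: chom_iff)
qed

section \<open>Duals and evaluation maps\<close>

lemma dual_D_simps [simp]:
  "fst (dual_D P (Q, T) A) = substruct (power_struct Q (carr A)) (homs A P)"
  "snd (dual_D P (Q, T) A) = subtopology (tpower (carr A) T) (homs A P)"
  by (simp_all add: dual_D_def)

lemma dual_E_eq: "dual_E P (Q, T) X = substruct (power_struct P (carr (fst X))) (chom X (Q, T))"
  by (simp add: dual_E_def)

lemma dual_D_IScPp: "A \<in> ISP P \<Longrightarrow> dual_D P (Q, T) A \<in> IScPp (Q, T)"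
  unfolding dual_D_def using ISP_D[OF _ is_struct_P]
  by (intro closed_substruct_IScPp[OF Q] subuniverse_homs closedin_homs) auto

lemma dual_E_ISP: "X \<in> IScPp (Q, T) \<Longrightarrow> dual_E P (Q, T) X \<in> ISP P"
  unfolding dual_E_eq using IScPp_D[OF _ Q, of X]
  by (intro substruct_power_ISP[OF is_struct_P] subuniverse_chom) auto

lemma evaluation_chom:
  assumes A: "A \<in> ISP P" and "a \<in> carr A"
  shows "(\<lambda>x\<in>homs A P. x a) \<in> chom (dual_D P (Q, T) A) (Q, T)"
  unfolding dual_D_def using projection_chom[OF Q subuniverse_homs assms(2)] ISP_D[OF A is_struct_P] by simp

lemma evaluation_homs:
  assumes X: "X \<in> IScPp (Q, T)" and "x \<in> carr (fst X)"
  shows "(\<lambda>\<alpha>\<in>chom X (Q, T). \<alpha> x) \<in> homs (dual_E P (Q, T) X) P"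
  unfolding dual_E_eq using projection_homs_sub[OF is_struct_P subuniverse_chom assms(2)] IScPp_D[OF X Q] by simp

text \<open>Evaluation on an arbitrary separating substructure \<open>U\<close> of the dual. With
  \<open>U\<close> the whole dual it is \<open>eval_e\<close>; proper choices of \<open>U\<close>
  are what the argument on closed separating substructures needs.\<close>

lemma eval_into_dual_E:
  assumes A: "A \<in> ISP P" and U: "U \<subseteq> homs A P" "subuniverse U (power_struct Q (carr A))"
    and s: "separates_struct U A P"
  defines "Y \<equiv> tsubstruct (tpower_struct (Q, T) (carr A)) U"
  assumes Y: "topspace (snd Y) = U"
  shows "(\<lambda>a\<in>carr A. \<lambda>u\<in>U. u a) \<in> homs A (dual_E P (Q, T) Y)"
    and "separates_struct {\<lambda>a\<in>carr A. \<lambda>u\<in>U. u a} A (dual_E P (Q, T) Y)"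
proof -
  note Ad = ISP_D[OF A is_struct_P]
  have cY: "carr (fst Y) = U" "is_struct (fst Y)" "sg (fst Y) = sg Q"
    using is_struct_substruct[OF U(2) is_struct_power[OF is_struct_Q]] by (simp_all add: Y_def)
  have sub: "subuniverse (chom Y (Q, T)) (power_struct P U)"
    using subuniverse_chom[of Y] cY Y by simp
  have "(\<lambda>a\<in>carr A. \<lambda>u\<in>U. u a) \<in> homs A (power_struct P U)"
    using U(1) by (intro tupling_homs[OF Ad(1) _ Ad(3)]) auto
  moreover have "(\<lambda>a\<in>carr A. \<lambda>u\<in>U. u a) ` carr A \<subseteq> chom Y (Q, T)"
    using projection_chom[OF Q U(2)] by (auto simp: Y_def)
  ultimately show "(\<lambda>a\<in>carr A. \<lambda>u\<in>U. u a) \<in> homs A (dual_E P (Q, T) Y)"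
    unfolding dual_E_eq cY(1) using sub
    by (subst homs_substruct_iff[OF Ad(1)]) (auto simp: subuniverse_def)
  show "separates_struct {\<lambda>a\<in>carr A. \<lambda>u\<in>U. u a} A (dual_E P (Q, T) Y)"
    unfolding dual_E_eq cY(1)
    by (rule separates_struct_codom[OF separates_tupling[OF _ Ad(3)]]) (use s in auto)
qed

lemma eval_into_dual_D:
  assumes X: "X \<in> IScPp (Q, T)" and V: "V \<subseteq> chom X (Q, T)" "subuniverse V (power_struct P (carr (fst X)))"
    and s: "separates_struct V (fst X) Q"
  defines "C \<equiv> substruct (power_struct P (carr (fst X))) V"
  shows "(\<lambda>x\<in>carr (fst X). \<lambda>v\<in>V. v x) \<in> chom X (dual_D P (Q, T) C)"
    and "separates_struct {\<lambda>x\<in>carr (fst X). \<lambda>v\<in>V. v x} (fst X) (fst (dual_D P (Q, T) C))"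
proof -
  note Xd = IScPp_D[OF X Q]
  have C: "carr C = V" "is_struct C" "sg C = sg P"
    using is_struct_substruct[OF V(2) is_struct_power[OF is_struct_P]] by (simp_all add: C_def)
  have sub: "subuniverse (homs C P) (power_struct Q V)"
    using subuniverse_homs[of C] C by simp
  let ?e = "\<lambda>x\<in>carr (fst X). \<lambda>v\<in>V. v x"
  have "?e \<in> homs (fst X) (power_struct Q V)"
    using V(1) by (intro tupling_homs[OF Xd(1) _ Xd(6)]) (auto simp: chom_iff)
  moreover have im: "?e ` carr (fst X) \<subseteq> homs C P"
    using projection_homs_sub[OF is_struct_P V(2)] by (auto simp: C_def)
  ultimately have "?e \<in> homs (fst X) (fst (dual_D P (Q, T) C))"
    unfolding dual_D_simps C(1) using sub
    by (subst homs_substruct_iff[OF Xd(1)]) (auto simp: subuniverse_def)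
  moreover have "continuous_map (snd X) (snd (dual_D P (Q, T) C)) ?e"
  proof -
    have "continuous_map (snd X) (tpower V T) ?e"
      using V(1) by (intro continuous_map_tupling[OF Xd(2)]) (auto simp: chom_iff)
    then show ?thesis
      using im unfolding dual_D_simps C(1) continuous_map_in_subtopology Xd(2) image_subset_iff_funcset
      by (rule conjI)
  qed
  ultimately show "?e \<in> chom X (dual_D P (Q, T) C)" by (simp add: chom_iff)
  show "separates_struct {?e} (fst X) (fst (dual_D P (Q, T) C))"
    unfolding dual_D_simps C(1)
    by (rule separates_struct_codom[OF separates_tupling[OF _ Xd(6)]]) (use s in auto)
qed

text \<open>Since \<open>homs A P\<close> separates \<open>A\<close>, evaluation is an embedding for
  every alter ego. What a duality adds is that every morphism on the dual is the evaluation at a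
  point.\<close>

lemma eval_e_iso_iff:
  assumes A: "A \<in> ISP P"
  shows "iso_struct A (dual_E P (Q, T) (dual_D P (Q, T) A)) (eval_e P A) \<longleftrightarrow>
    chom (dual_D P (Q, T) A) (Q, T) \<subseteq> (\<lambda>a. \<lambda>x\<in>homs A P. x a) ` carr A"
proof -
  note Ad = ISP_D[OF A is_struct_P]
  have 1: "eval_e P A \<in> homs A (dual_E P (Q, T) (dual_D P (Q, T) A))"
      "separates_struct {eval_e P A} A (dual_E P (Q, T) (dual_D P (Q, T) A))"
    using eval_into_dual_E[OF A subset_refl subuniverse_homs[OF Ad(1,3)] Ad(4)]
      closedin_subset[OF closedin_homs[OF Ad(1,3)]]
    by (simp_all add: eval_e_def dual_D_def Int_absorb1)
  have E: "is_struct (dual_E P (Q, T) (dual_D P (Q, T) A))"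
    using ISP_D(1)[OF dual_E_ISP[OF dual_D_IScPp[OF A]] is_struct_P] .
  have "eval_e P A ` carr A = (\<lambda>a. \<lambda>x\<in>homs A P. x a) ` carr A" by (simp add: eval_e_def)
  moreover have "eval_e P A ` carr A \<subseteq> chom (dual_D P (Q, T) A) (Q, T)"
    using evaluation_chom[OF A] by (auto simp: eval_e_def)
  ultimately show ?thesis
    unfolding iso_struct_iff[OF Ad(1) E] using 1 by (auto simp: dual_E_eq)
qed

lemma eval_eps_iso_iff:
  assumes X: "X \<in> IScPp (Q, T)"
  shows "iso_tstruct X (dual_D P (Q, T) (dual_E P (Q, T) X)) (eval_eps (Q, T) X) \<longleftrightarrow>
    homs (dual_E P (Q, T) X) P \<subseteq> (\<lambda>x. \<lambda>\<alpha>\<in>chom X (Q, T). \<alpha> x) ` carr (fst X)"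
proof -
  note Xd = IScPp_D[OF X Q]
  have 1: "eval_eps (Q, T) X \<in> chom X (dual_D P (Q, T) (dual_E P (Q, T) X))"
      "separates_struct {eval_eps (Q, T) X} (fst X) (fst (dual_D P (Q, T) (dual_E P (Q, T) X)))"
    using eval_into_dual_D[OF X subset_refl subuniverse_chom[OF Xd(1,2,6)] Xd(5)]
    by (simp_all add: eval_eps_def dual_E_eq)
  note Yd = IScPp_D[OF dual_D_IScPp[OF dual_E_ISP[OF X]] Q]
  have "eval_eps (Q, T) X ` carr (fst X) = (\<lambda>x. \<lambda>\<alpha>\<in>chom X (Q, T). \<alpha> x) ` carr (fst X)"
    by (simp add: eval_eps_def)
  moreover have "eval_eps (Q, T) X ` carr (fst X) \<subseteq> homs (dual_E P (Q, T) X) P"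
    using evaluation_homs[OF X] by (auto simp: eval_eps_def)
  ultimately show ?thesis
    unfolding iso_tstruct_iff[OF Xd(1-3) Yd(1,2,7)] using 1 by auto
qed

text \<open>All later uses of full duality, for the given and for the new pair, go through this
  surjectivity form.\<close>

lemma fully_dualises_iff:
  "fully_dualises TYPE('u) (Q, T) P \<longleftrightarrow>
    (\<forall>A :: ('u, 'f1, 'r1) struct. A \<in> ISP P \<longrightarrow>
       chom (dual_D P (Q, T) A) (Q, T) \<subseteq> (\<lambda>a. \<lambda>x\<in>homs A P. x a) ` carr A) \<and>
    (\<forall>X :: ('u, 'f2, 'r2) tstruct. X \<in> IScPp (Q, T) \<longrightarrow>
       homs (dual_E P (Q, T) X) P \<subseteq> (\<lambda>x. \<lambda>\<alpha>\<in>chom X (Q, T). \<alpha> x) ` carr (fst X))"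
  unfolding fully_dualises_def Ball_def
  by (simp only: ego eval_e_iso_iff eval_eps_iso_iff simp_thms cong: imp_cong)

end

section \<open>Separating substructures of duals\<close>

context dual_pair
begin

text \<open>
  By injectivity and duality \<open>A\<close> is isomorphic to the dual of \<open>U\<close>, so that \<open>\<phi>\<close> becomes a morphism on the
  dual of \<open>U\<close>; by duality for \<open>U\<close> it is the evaluation at some \<open>u \<in> U\<close>, which forces \<open>\<phi> = u\<close>.
\<close>

lemma closed_separating_eq_homs:
  fixes A :: "('u, 'f1, 'r1) struct"
  assumes full: "fully_dualises TYPE('u) (Q, T) P" "fully_dualises TYPE('u \<Rightarrow> 'm) (Q, T) P"
    and inj: "injective_IScPp TYPE('u \<Rightarrow> 'm) (Q, T)"
    and A: "A \<in> ISP P" and U: "U \<subseteq> homs A P" "subuniverse U (power_struct Q (carr A))"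
      "closedin (tpower (carr A) T) U" "separates_struct U A P"
  shows "U = homs A P"
proof (intro subset_antisym U(1) subsetI)
  fix \<phi> assume \<phi>: "\<phi> \<in> homs A P"
  note Ad = ISP_D[OF A is_struct_P]
  define Y where "Y = tsubstruct (tpower_struct (Q, T) (carr A)) U"
  have Y: "Y \<in> IScPp (Q, T)" unfolding Y_def by (rule closed_substruct_IScPp[OF Q U(2) Ad(2) U(3)])
  have cY: "fst Y = substruct (power_struct Q (carr A)) U" "snd Y = subtopology (tpower (carr A) T) U" "carr (fst Y) = U"
    by (simp_all add: Y_def)
  note Yd = IScPp_D[OF Y Q]
  let ?X = "dual_D P (Q, T) A"
  have X: "?X \<in> IScPp (Q, T)" by (rule dual_D_IScPp[OF A])
  note Xd = IScPp_D[OF X Q]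
  let ?i = "\<lambda>u\<in>U. u"
  have hsub: "homs A P \<subseteq> carr (power_struct Q (carr A))"
    using subuniverse_homs[OF Ad(1,3)] by (simp add: subuniverse_def)
  have ih: "?i \<in> homs (fst Y) (power_struct Q (carr A))"
    using inclusion_homs(1)[OF is_struct_power[OF is_struct_Q] U(2)] by (simp add: cY)
  have "?i \<in> homs (fst Y) (fst ?X)"
    unfolding dual_D_simps homs_substruct_iff[OF Yd(1) hsub] using ih U(1) by (simp add: cY)
  moreover have "continuous_map (snd Y) (tpower (carr A) T) ?i"
    unfolding cY by (rule continuous_map_eq[OF continuous_map_from_subtopology[OF continuous_map_id]]) simp
  then have "continuous_map (snd Y) (snd ?X) ?i"
    unfolding dual_D_simps continuous_map_in_subtopology using U(1) by (auto simp: cY)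
  moreover have "separates_struct {?i} (fst Y) (fst ?X)"
    unfolding dual_D_simps cY(1)
    by (rule separates_struct_codom[OF inclusion_homs(2)[OF is_struct_power[OF is_struct_Q] U(2)]]) simp
  ultimately have emb: "tembedding Y ?X ?i"
    using tembedding_iff[OF Yd(1-3) Xd(1,2,7)] by (simp add: chom_iff)
  let ?e = "\<lambda>a\<in>carr A. \<lambda>u\<in>U. u a"
  have "chom Y (Q, T) \<subseteq> ?e ` carr A"
  proof
    fix \<beta> assume \<beta>: "\<beta> \<in> chom Y (Q, T)"
    then obtain g where g: "g \<in> chom ?X (Q, T)" "compose (carr (fst Y)) g ?i = \<beta>"
      using inj X Y emb unfolding injective_IScPp_def by metis
    then obtain a where a: "a \<in> carr A" "g = (\<lambda>x\<in>homs A P. x a)"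
      using full(1) A unfolding fully_dualises_iff by blast
    have "\<beta> = ?e a"
      unfolding g(2)[symmetric] a(2) cY(3) compose_def using a(1) U(1) by (auto simp: fun_eq_iff)
    then show "\<beta> \<in> ?e ` carr A" using a(1) by blast
  qed
  moreover have top: "topspace (snd Y) = U" using Yd(2) cY by simp
  note e = eval_into_dual_E[OF A U(1,2,4), folded Y_def, OF top]
  moreover have eY: "?e a \<in> chom Y (Q, T)" if "a \<in> carr A" for a
    using funcset_mem[OF homs_Pi[OF e(1)] that] by (simp only: dual_E_eq struct_sel_simps)
  then have "?e ` carr A \<subseteq> chom Y (Q, T)" by blast
  ultimately have "iso_struct A (dual_E P (Q, T) Y) ?e"
    using iso_struct_iff[OF Ad(1) ISP_D(1)[OF dual_E_ISP[OF Y] is_struct_P]] by (simp add: dual_E_eq)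
  then obtain q where q: "q \<in> homs (dual_E P (Q, T) Y) A" "\<forall>a\<in>carr A. q (?e a) = a"
    by (rule iso_struct_inverse)
  have "compose (chom Y (Q, T)) \<phi> q \<in> homs (dual_E P (Q, T) Y) P"
    using homs_comp[OF ISP_D(1)[OF dual_E_ISP[OF Y] is_struct_P] q(1) \<phi>] by (simp add: dual_E_eq)
  \<comment> \<open>The elements of \<open>Y\<close> are functions on \<open>A\<close>, so the
    duality applied to \<open>Y\<close> is the one at the function type.\<close>
  then obtain u where u: "u \<in> U" "compose (chom Y (Q, T)) \<phi> q = (\<lambda>\<alpha>\<in>chom Y (Q, T). \<alpha> u)"
    using full(2) Y unfolding fully_dualises_iff cY(3)[symmetric] by blast
  \<comment> \<open>Evaluate the equation at \<open>?e a\<close>, which \<open>q\<close> sends back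
    to \<open>a\<close>.\<close>
  have "\<phi> a = u a" if a: "a \<in> carr A" for a
  proof -
    show ?thesis using eY[OF a] fun_cong[OF u(2), of "?e a"] bspec[OF q(2) a] a u(1) by (simp add: compose_eq)
  qed
  then have "\<phi> = u"
    using homs_PiE[OF \<phi>] homs_PiE[of u A P] u(1) U(1) by (intro PiE_ext[of \<phi> "carr A" "\<lambda>_. carr P" u]) auto
  then show "\<phi> \<in> U" using u(1) by simp
qed

text \<open>The mirror image of \<open>closed_separating_eq_homs\<close>: injectivity of
  \<open>P\<close> extends morphisms from \<open>V\<close> to the whole dual. That dual carries no
  topology, so \<open>V\<close> need not be closed, but it must be non-empty to be a member of
  \<open>ISP P\<close>.\<close>

lemma separating_eq_chom:
  fixes X :: "('u, 'f2, 'r2) tstruct"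
  assumes full: "fully_dualises TYPE('u) (Q, T) P" "fully_dualises TYPE('u \<Rightarrow> 'm) (Q, T) P"
    and inj: "injective_ISP TYPE('u \<Rightarrow> 'm) P"
    and X: "X \<in> IScPp (Q, T)" and V: "V \<subseteq> chom X (Q, T)" "V \<noteq> {}"
      "subuniverse V (power_struct P (carr (fst X)))" "separates_struct V (fst X) Q"
  shows "V = chom X (Q, T)"
proof (intro subset_antisym V(1) subsetI)
  fix \<beta> assume \<beta>: "\<beta> \<in> chom X (Q, T)"
  note Xd = IScPp_D[OF X Q]
  let ?B = "dual_E P (Q, T) X"
  have B: "?B \<in> ISP P" by (rule dual_E_ISP[OF X])
  define C where "C = substruct (power_struct P (carr (fst X))) V"
  have C: "C \<in> ISP P" unfolding C_def by (rule substruct_power_ISP[OF is_struct_P V(2,3)])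
  note Cd = ISP_D[OF C is_struct_P]
  have cC: "carr C = V" by (simp add: C_def)
  let ?i = "\<lambda>v\<in>V. v"
  have csub: "chom X (Q, T) \<subseteq> carr (power_struct P (carr (fst X)))"
    using subuniverse_chom[OF Xd(1,2,6)] by (simp add: subuniverse_def)
  have "?i \<in> homs C (power_struct P (carr (fst X)))"
    using inclusion_homs(1)[OF is_struct_power[OF is_struct_P] V(3)] by (simp add: C_def)
  then have "?i \<in> homs C ?B"
    unfolding dual_E_eq homs_substruct_iff[OF Cd(1) csub] using V(1) by (simp add: cC)
  moreover have "separates_struct {?i} C ?B"
    unfolding dual_E_eq C_def
    by (rule separates_struct_codom[OF inclusion_homs(2)[OF is_struct_power[OF is_struct_P] V(3)]]) simp
  ultimately have emb: "embedding C ?B ?i"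
    using embedding_iff[OF Cd(1)] Cd(2) by blast
  let ?e = "\<lambda>x\<in>carr (fst X). \<lambda>v\<in>V. v x"
  have "homs C P \<subseteq> ?e ` carr (fst X)"
  proof
    fix \<phi> assume \<phi>: "\<phi> \<in> homs C P"
    then obtain g where g: "g \<in> homs ?B P" "compose (carr C) g ?i = \<phi>"
      using inj B C emb unfolding injective_ISP_def by metis
    then obtain x where x: "x \<in> carr (fst X)" "g = (\<lambda>\<alpha>\<in>chom X (Q, T). \<alpha> x)"
      using full(1) X unfolding fully_dualises_iff by blast
    have "\<phi> = ?e x"
      unfolding g(2)[symmetric] x(2) cC compose_def using x(1) V(1) by (auto simp: fun_eq_iff)
    then show "\<phi> \<in> ?e ` carr (fst X)" using x(1) by blast
  qed
  moreover note e = eval_into_dual_D[OF X V(1,3,4), folded C_def]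
  moreover have im: "?e ` carr (fst X) \<subseteq> homs C P"
  proof -
    have "?e \<in> homs (fst X) (fst (dual_D P (Q, T) C))" using e(1) unfolding chom_iff by blast
    from homs_Pi[OF this] show ?thesis unfolding dual_D_simps struct_sel_simps image_subset_iff_funcset .
  qed
  \<comment> \<open>\<open>X\<close> is compact and the dual of \<open>C\<close> is Hausdorff, so a
    continuous, surjective, separating \<open>?e\<close> is already an isomorphism with
    topology.\<close>
  ultimately have iso: "iso_tstruct X (dual_D P (Q, T) C) ?e"
    using iso_tstruct_iff[OF Xd(1-3) IScPp_D(1,2,7)[OF dual_D_IScPp[OF C] Q]] by simp
  obtain q where q: "q \<in> chom (dual_D P (Q, T) C) X" "\<forall>x\<in>carr (fst X). q (?e x) = x"
    by (rule iso_tstruct_inverse[OF iso Xd(2) IScPp_D(2)[OF dual_D_IScPp[OF C] Q]])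
  have "compose (homs C P) \<beta> q \<in> chom (dual_D P (Q, T) C) (Q, T)"
    using chom_comp[OF IScPp_D(1,2)[OF dual_D_IScPp[OF C] Q] q(1) \<beta>] by simp
  then obtain v where v: "v \<in> V" "compose (homs C P) \<beta> q = (\<lambda>\<phi>\<in>homs C P. \<phi> v)"
    using full(2) C unfolding fully_dualises_iff cC[symmetric] by blast
  have "\<beta> x = v x" if x: "x \<in> carr (fst X)" for x
  proof -
    have "?e x \<in> homs C P" using im x by blast
    then show ?thesis using fun_cong[OF v(2), of "?e x"] bspec[OF q(2) x] x v(1) by (simp add: compose_eq)
  qed
  moreover have "\<beta> \<in> carr (fst X) \<rightarrow>\<^sub>E carr P" "v \<in> carr (fst X) \<rightarrow>\<^sub>E carr P"
    using csub \<beta> v(1) V(1) by auto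
  ultimately have "\<beta> = v" by (intro PiE_ext)
  then show "\<beta> \<in> V" using v(1) by simp
qed

end

section \<open>Transfer along \<open>\<omega>\<close>\<close>

text \<open>Evaluate the term in the substructure on \<open>U\<close> at the single argument
  \<open>z\<close>: the value stays in \<open>U\<close>, and the projections, being homomorphisms,
  show that it is the term function applied in each coordinate.\<close>

lemma subuniverse_Clo1:
  assumes P: "is_struct P" and U: "subuniverse U (power_struct P S)" and z: "z \<in> U" and u: "u \<in> Clo1 P"
  shows "compose S u z \<in> U"
proof -
  obtain t where t: "wf_trm (sg P) 1 t" "u = (\<lambda>x\<in>carr P. trm_val P (\<lambda>i\<in>{..<1}. x) t)"
    using u unfolding Clo1_def by blast
  let ?D = "substruct (power_struct P S) U" and ?v = "\<lambda>i\<in>{..<1::nat}. z"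
  have D: "is_struct ?D" by (rule is_struct_substruct[OF U is_struct_power[OF P]])
  have v: "?v \<in> tuples 1 (carr ?D)" using z by auto
  have tU: "trm_val ?D ?v t \<in> U" using trm_val_closed[OF D v] t(1) by simp
  have US: "U \<subseteq> S \<rightarrow>\<^sub>E carr P" using U by (simp add: subuniverse_def)
  have "trm_val ?D ?v t s = compose S u z s" if s: "s \<in> S" for s
  proof -
    have "trm_val ?D ?v t s = trm_val P (compose {..<1} (\<lambda>x\<in>U. x s) ?v) t"
      using conjunct2[OF trm_val_hom[OF D projection_homs_sub[OF P U s] v, of t]] t(1) tU by simp
    also have "compose {..<1} (\<lambda>x\<in>U. x s) ?v = (\<lambda>i\<in>{..<1::nat}. z s)"
      using z by (auto simp: compose_def fun_eq_iff)
    also have "trm_val P (\<lambda>i\<in>{..<1::nat}. z s) t = compose S u z s"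
    proof -
      have "z s \<in> carr P" using z US s by blast
      then show ?thesis using s t(2) by (simp add: compose_eq)
    qed
    finally show ?thesis .
  qed
  moreover have "trm_val ?D ?v t \<in> extensional S" using tU US by (auto simp: PiE_iff)
  ultimately have "trm_val ?D ?v t = compose S u z"
    by (intro extensionalityI[of _ S]) auto
  then show ?thesis using tU by simp
qed

text \<open>A term commutes with every morphism \<open>x\<close>, so applying it to the evaluation
  at \<open>a\<close> gives the evaluation at the value of the term at \<open>a\<close>.\<close>

lemma Clo1_evaluation:
  assumes A: "is_struct A" and sg: "sg A = sg P" and U: "U \<subseteq> homs A P" and a: "a \<in> carr A" and u: "u \<in> Clo1 P"
  shows "compose U u (\<lambda>x\<in>U. x a) \<in> (\<lambda>a. \<lambda>x\<in>U. x a) ` carr A"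
proof -
  obtain t where t: "wf_trm (sg A) 1 t" "u = (\<lambda>x\<in>carr P. trm_val P (\<lambda>i\<in>{..<1}. x) t)"
    using u unfolding Clo1_def sg by blast
  let ?v = "\<lambda>i\<in>{..<1::nat}. a"
  have v: "?v \<in> tuples 1 (carr A)" using a by auto
  have "compose U u (\<lambda>x\<in>U. x a) = (\<lambda>x\<in>U. x (trm_val A ?v t))"
    unfolding compose_def
  proof (rule restrict_ext)
    fix x assume "x \<in> U"
    then have x: "x \<in> homs A P" using U by blast
    have "compose {..<1} x ?v = (\<lambda>i\<in>{..<1::nat}. x a)" by (auto simp: compose_def fun_eq_iff)
    moreover have "x a \<in> carr P" using homs_Pi[OF x] a by blast
    ultimately show "u ((\<lambda>x\<in>U. x a) x) = x (trm_val A ?v t)"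
      using trm_val_hom[OF A x v t(1)] \<open>x \<in> U\<close> t(2) by simp
  qed
  then show ?thesis using trm_val_closed[OF A v t(1)] by blast
qed

locale transfer = M: dual_pair M1 M2 T + N: dual_pair N1 N2 TN
  for M1 :: "('m, 'f1, 'r1) struct" and M2 :: "('m, 'f2, 'r2) struct" and T :: "'m topology"
    and N1 :: "('n, 'g1, 'q1) struct" and N2 :: "('n, 'g2, 'q2) struct" and TN :: "'n topology" +
  fixes \<rho>1 :: "('f1, 'r1, 'g1, 'q1) scheme" and \<rho>2 :: "('f2, 'r2, 'g2, 'q2) scheme"
    and \<omega> :: "'m \<Rightarrow> 'n"
  assumes scheme1: "reduct_scheme (sg M1) (sg N1) \<rho>1" and scheme2: "reduct_scheme (sg M2) (sg N2) \<rho>2"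
    and \<omega>_cont: "continuous_map T TN \<omega>"
    and \<omega>1: "\<omega> \<in> homs (flat (sg N1) \<rho>1 M1) N1" and \<omega>2: "\<omega> \<in> homs (flat (sg N2) \<rho>2 M2) N2"
    and sep1: "separates_struct (comp_set (carr M1) \<omega> (Clo1 M2)) (flat (sg N1) \<rho>1 M1) N1"
    and sep2: "separates_struct (comp_set (carr M1) \<omega> (Clo1 M1)) (flat (sg N2) \<rho>2 M2) N2"
begin

lemma swap: "transfer M2 M1 T N2 N1 TN \<rho>2 \<rho>1 \<omega>"
  by (intro transfer.intro M.swap N.swap transfer_axioms.intro)
    (use scheme1 scheme2 \<omega>_cont \<omega>1 \<omega>2 sep1 sep2 M.carr_eq in simp_all)

abbreviation "F1 \<equiv> flat (sg N1) \<rho>1"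
abbreviation "F2 \<equiv> flat (sg N2) \<rho>2"
abbreviation "F2T \<equiv> tflat (sg N2) \<rho>2"

lemma F2T_simps [simp]: "fst (F2T X) = F2 (fst X)" "snd (F2T X) = snd X"
  by (simp_all add: tflat_def)

lemma \<omega>_homs:
  assumes "is_struct A" "sg A = sg M1" "x \<in> homs A M1"
  shows "compose (carr A) \<omega> x \<in> homs (F1 A) N1"
proof -
  have \<rho>: "reduct_scheme (sg A) (sg N1) \<rho>1" using scheme1 assms(2) by simp
  show ?thesis
    using homs_comp[OF is_struct_flat[OF assms(1) \<rho>] homs_flat[OF assms(1) \<rho> assms(3)] \<omega>1] by simp
qed

lemma \<omega>_homs2:
  assumes "is_struct X" "sg X = sg M2" "x \<in> homs X M2"
  shows "compose (carr X) \<omega> x \<in> homs (F2 X) N2"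
  using transfer.\<omega>_homs[OF swap assms] .

lemma \<omega>_chom:
  assumes "is_struct (fst X)" "topspace (snd X) = carr (fst X)" "sg (fst X) = sg M2" "\<alpha> \<in> chom X (M2, T)"
  shows "compose (carr (fst X)) \<omega> \<alpha> \<in> chom (F2T X) (N2, TN)"
proof -
  have "continuous_map (snd X) TN (\<omega> \<circ> \<alpha>)"
    using assms(4) by (auto simp: chom_iff intro: continuous_map_compose[OF _ \<omega>_cont])
  then have "continuous_map (snd X) TN (compose (carr (fst X)) \<omega> \<alpha>)"
    by (rule continuous_map_eq) (simp add: assms(2) compose_def)
  then show ?thesis using \<omega>_homs2[OF assms(1,3)] assms(4) by (simp add: chom_iff)
qed

text \<open>\<open>Z\<close> separates the reduct of \<open>X\<close> into the reduct of
  \<open>M2\<close>, and \<omega> after the terms of \<open>M1\<close> continues to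
  \<open>N2\<close>. Closure of \<open>Z\<close> under these terms absorbs them, leaving \<omega>
  alone.\<close>

lemma separates_\<omega>:
  assumes X: "is_struct X" "sg X = sg M2" and Z: "Z \<subseteq> homs X M2" "separates_struct Z X M2"
    and cl: "\<And>z u. z \<in> Z \<Longrightarrow> u \<in> Clo1 M1 \<Longrightarrow> compose (carr X) u z \<in> Z"
  shows "separates_struct (compose (carr X) \<omega> ` Z) (F2 X) N2"
proof (rule separates_struct_comp[OF _ _ sep2])
  have \<rho>: "reduct_scheme (sg X) (sg N2) \<rho>2" using scheme2 X(2) by simp
  show "Z \<subseteq> homs (F2 X) (F2 M2)" using Z(1) homs_flat[OF X(1) \<rho>] by blast
  show "separates_struct Z (F2 X) (F2 M2)" by (rule separates_struct_flat[OF X(1) \<rho> Z])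
  fix z w assume z: "z \<in> Z" and "w \<in> comp_set (carr M1) \<omega> (Clo1 M1)"
  then obtain u where u: "u \<in> Clo1 M1" "w = compose (carr M1) \<omega> u" by (auto simp: comp_set_def)
  have "z x \<in> carr M1" if "x \<in> carr X" for x
    using homs_Pi[of z X M2] Z(1) z that by (auto simp: M.carr_eq)
  then have "compose (carr (F2 X)) w z = compose (carr X) \<omega> (compose (carr X) u z)"
    using u(2) by (auto simp: compose_def fun_eq_iff)
  then show "compose (carr (F2 X)) w z \<in> compose (carr X) \<omega> ` Z" using cl[OF z u(1)] by simp
qed

lemma separates_\<omega>_chom:
  assumes X: "X \<in> IScPp (M2, T)"
  shows "separates_struct (compose (carr (fst X)) \<omega> ` chom X (M2, T)) (F2 (fst X)) N2"
proof -
  note Xd = IScPp_D[OF X M.Q]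
  show ?thesis
    by (rule separates_\<omega>[OF Xd(1,6) _ Xd(5) subuniverse_Clo1[OF M.is_struct_P M.subuniverse_chom[OF Xd(1,2,6)]]])
      (auto simp: chom_iff)
qed

lemma separates_\<omega>_homs:
  assumes A: "A \<in> ISP M1"
  shows "separates_struct (compose (carr A) \<omega> ` homs A M1) (F1 A) N1"
proof -
  interpret sw: transfer M2 M1 T N2 N1 TN \<rho>2 \<rho>1 \<omega> by (rule swap)
  note Ad = ISP_D[OF A M.is_struct_P]
  show ?thesis
    by (rule sw.separates_\<omega>[OF Ad(1,3) _ Ad(4) subuniverse_Clo1[OF M.is_struct_Q M.subuniverse_homs[OF Ad(1,3)]]]) auto
qed

lemma F1_ISP:
  assumes A: "A \<in> ISP M1"
  shows "F1 A \<in> ISP N1"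
proof -
  note Ad = ISP_D[OF A M.is_struct_P]
  have "separates_struct (homs (F1 A) N1) (F1 A) N1"
    by (rule separates_struct_mono[OF separates_\<omega>_homs[OF A]]) (use \<omega>_homs[OF Ad(1,3)] in blast)
  then show ?thesis
    unfolding ISP_iff[OF N.is_struct_P] using Ad is_struct_flat[OF Ad(1)] scheme1 by simp
qed

lemma F2T_IScPp:
  assumes X: "X \<in> IScPp (M2, T)"
  shows "F2T X \<in> IScPp (N2, TN)"
proof -
  note Xd = IScPp_D[OF X M.Q]
  have "separates_struct (chom (F2T X) (N2, TN)) (F2 (fst X)) N2"
    by (rule separates_struct_mono[OF separates_\<omega>_chom[OF X]]) (use \<omega>_chom[OF Xd(1,2,6)] in blast)
  moreover have "chom (F2T X) (N2, TN) \<noteq> {}" using \<omega>_chom[OF Xd(1,2,6)] Xd(4) by blast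
  ultimately show ?thesis
    unfolding IScPp_iff[OF N.Q] using Xd is_struct_flat[OF Xd(1)] scheme2 by simp
qed

section \<open>The comparison maps x \<mapsto> \<omega> \<circ> x and \<alpha> \<mapsto> \<omega>
  \<circ> \<alpha>\<close>

definition \<Phi> :: "('u, 'f1, 'r1) struct \<Rightarrow> ('u \<Rightarrow> 'm) \<Rightarrow> 'u \<Rightarrow> 'n" where
  "\<Phi> A = (\<lambda>x\<in>homs A M1. compose (carr A) \<omega> x)"

definition \<Psi> :: "('u, 'f2, 'r2) tstruct \<Rightarrow> ('u \<Rightarrow> 'm) \<Rightarrow> 'u \<Rightarrow> 'n" where
  "\<Psi> X = (\<lambda>\<alpha>\<in>chom X (M2, T). compose (carr (fst X)) \<omega> \<alpha>)"

text \<open>Composition with \<omega> on \<open>H\<close> is the tupling of the maps \<omega> after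
  a projection. Stating this for any substructure of a power serves both kinds of duals, the second
  one through \<open>swap\<close>.\<close>

lemma
  assumes X: "is_struct X" "sg X = sg M2" and H: "subuniverse H (power_struct M2 S)"
    and X_eq: "X = substruct (power_struct M2 S) H"
    and cl: "\<And>s u. s \<in> S \<Longrightarrow> u \<in> Clo1 M1 \<Longrightarrow> compose H u (\<lambda>x\<in>H. x s) \<in> (\<lambda>s. \<lambda>x\<in>H. x s) ` S"
  shows \<omega>_power_homs: "(\<lambda>x\<in>H. compose S \<omega> x) \<in> homs (F2 X) (power_struct N2 S)"
    and \<omega>_power_separates: "separates_struct {\<lambda>x\<in>H. compose S \<omega> x} (F2 X) (power_struct N2 S)"
proof -
  have cX: "carr X = H" by (simp add: X_eq)
  let ?z = "\<lambda>s. compose H \<omega> (\<lambda>x\<in>H. x s)"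
  have eq: "(\<lambda>x\<in>carr (F2 X). \<lambda>s\<in>S. ?z s x) = (\<lambda>x\<in>H. compose S \<omega> x)"
    by (auto simp: cX compose_def fun_eq_iff)
  have pr: "(\<lambda>x\<in>H. x s) \<in> homs X M2" if "s \<in> S" for s
    unfolding X_eq by (rule projection_homs_sub[OF M.is_struct_Q H that])
  have F: "is_struct (F2 X)" "sg (F2 X) = sg N2" using is_struct_flat[OF X(1)] scheme2 X(2) by simp_all
  have "?z s \<in> homs (F2 X) N2" if "s \<in> S" for s
    using \<omega>_homs2[OF X pr[OF that]] by (simp add: cX)
  then show "(\<lambda>x\<in>H. compose S \<omega> x) \<in> homs (F2 X) (power_struct N2 S)"
    unfolding eq[symmetric] by (rule tupling_homs[OF F(1) _ F(2)])
  have "separates_struct (compose (carr X) \<omega> ` (\<lambda>s. \<lambda>x\<in>H. x s) ` S) (F2 X) N2"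
  proof (rule separates_\<omega>[OF X])
    show "(\<lambda>s. \<lambda>x\<in>H. x s) ` S \<subseteq> homs X M2" using pr by blast
    show "separates_struct ((\<lambda>s. \<lambda>x\<in>H. x s) ` S) X M2"
      unfolding X_eq by (rule separates_projections_sub[OF M.is_struct_Q H])
    show "compose (carr X) u z \<in> (\<lambda>s. \<lambda>x\<in>H. x s) ` S"
      if "z \<in> (\<lambda>s. \<lambda>x\<in>H. x s) ` S" "u \<in> Clo1 M1" for z u
      using that cl by (auto simp: cX)
  qed
  then show "separates_struct {\<lambda>x\<in>H. compose S \<omega> x} (F2 X) (power_struct N2 S)"
    unfolding eq[symmetric] by (intro separates_tupling[OF _ F(2)]) (simp add: cX image_image)
qed

lemma
  assumes A: "A \<in> ISP M1"
  shows \<Phi>_power: "\<Phi> A \<in> homs (F2 (fst (dual_D M1 (M2, T) A))) (power_struct N2 (carr A))"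
    "separates_struct {\<Phi> A} (F2 (fst (dual_D M1 (M2, T) A))) (power_struct N2 (carr A))"
    and \<Phi>_cont: "continuous_map (subtopology (tpower (carr A) T) (homs A M1)) (tpower (carr A) TN) (\<Phi> A)"
    and \<Phi>_image: "\<Phi> A ` homs A M1 \<subseteq> homs (F1 A) N1"
    and \<Phi>_inj: "inj_on (\<Phi> A) (homs A M1)"
proof -
  note Ad = ISP_D[OF A M.is_struct_P]
  let ?X = "fst (dual_D M1 (M2, T) A)"
  note Xd = IScPp_D[OF M.dual_D_IScPp[OF A] M.Q]
  note sub = M.subuniverse_homs[OF Ad(1,3)]
  note cl = Clo1_evaluation[OF Ad(1,3) subset_refl]
  show "\<Phi> A \<in> homs (F2 ?X) (power_struct N2 (carr A))"
    unfolding \<Phi>_def using \<omega>_power_homs[OF Xd(1,6) sub _ cl] by simp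
  show s: "separates_struct {\<Phi> A} (F2 ?X) (power_struct N2 (carr A))"
    unfolding \<Phi>_def using \<omega>_power_separates[OF Xd(1,6) sub _ cl] by simp
  show "\<Phi> A ` homs A M1 \<subseteq> homs (F1 A) N1"
    using \<omega>_homs[OF Ad(1,3)] by (auto simp: \<Phi>_def)
  show "inj_on (\<Phi> A) (homs A M1)" using separates_inj_on[OF s] by simp
  let ?S = "subtopology (tpower (carr A) T) (homs A M1)"
  have top: "topspace ?S = homs A M1" using Xd(2) by simp
  have "continuous_map ?S TN (\<lambda>x. \<omega> (x a))" if "a \<in> carr A" for a
    using continuous_map_compose[OF continuous_map_from_subtopology[OF continuous_map_product_projection[OF that]] \<omega>_cont]
    by (simp add: o_def)
  from continuous_map_tupling[OF top this]
  have "continuous_map ?S (tpower (carr A) TN) (\<lambda>x\<in>homs A M1. \<lambda>a\<in>carr A. \<omega> (x a))" by simp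
  then show "continuous_map ?S (tpower (carr A) TN) (\<Phi> A)"
    by (simp add: \<Phi>_def compose_def)
qed

lemma
  assumes X: "X \<in> IScPp (M2, T)"
  shows \<Psi>_power: "\<Psi> X \<in> homs (F1 (dual_E M1 (M2, T) X)) (power_struct N1 (carr (fst X)))"
    "separates_struct {\<Psi> X} (F1 (dual_E M1 (M2, T) X)) (power_struct N1 (carr (fst X)))"
    and \<Psi>_image: "\<Psi> X ` chom X (M2, T) \<subseteq> chom (F2T X) (N2, TN)"
    and \<Psi>_inj: "inj_on (\<Psi> X) (chom X (M2, T))"
proof -
  interpret sw: transfer M2 M1 T N2 N1 TN \<rho>2 \<rho>1 \<omega> by (rule swap)
  note Xd = IScPp_D[OF X M.Q]
  let ?E = "dual_E M1 (M2, T) X"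
  note Ed = ISP_D[OF M.dual_E_ISP[OF X] M.is_struct_P]
  note sub = M.subuniverse_chom[OF Xd(1,2,6)]
  have cl: "compose (chom X (M2, T)) u (\<lambda>\<alpha>\<in>chom X (M2, T). \<alpha> x) \<in> (\<lambda>x. \<lambda>\<alpha>\<in>chom X (M2, T). \<alpha> x) ` carr (fst X)"
    if "x \<in> carr (fst X)" "u \<in> Clo1 M2" for x u
    by (rule Clo1_evaluation[OF Xd(1,6) _ that]) (auto simp: chom_iff)
  show "\<Psi> X \<in> homs (F1 ?E) (power_struct N1 (carr (fst X)))"
    unfolding \<Psi>_def by (rule sw.\<omega>_power_homs[OF Ed(1,3) sub M.dual_E_eq cl])
  show s: "separates_struct {\<Psi> X} (F1 ?E) (power_struct N1 (carr (fst X)))"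
    unfolding \<Psi>_def by (rule sw.\<omega>_power_separates[OF Ed(1,3) sub M.dual_E_eq cl])
  show "\<Psi> X ` chom X (M2, T) \<subseteq> chom (F2T X) (N2, TN)"
    using \<omega>_chom[OF Xd(1,2,6)] by (auto simp: \<Psi>_def)
  show "inj_on (\<Psi> X) (chom X (M2, T))" using separates_inj_on[OF s] by (simp add: M.dual_E_eq)
qed

lemma \<Phi>_iso:
  fixes A :: "('u, 'f1, 'r1) struct"
  assumes full: "fully_dualises_inj TYPE('u) (N2, TN) N1" "fully_dualises_inj TYPE('u \<Rightarrow> 'n) (N2, TN) N1"
    and A: "A \<in> ISP M1"
  shows "iso_in_IScPp (N2, TN) (F2T (dual_D M1 (M2, T) A)) (dual_D N1 (N2, TN) (F1 A)) (\<Phi> A)"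
proof -
  note Ad = ISP_D[OF A M.is_struct_P] and FA = F1_ISP[OF A]
  note FAd = ISP_D[OF FA N.is_struct_P]
  let ?X = "dual_D M1 (M2, T) A" and ?Y = "dual_D N1 (N2, TN) (F1 A)"
  have X: "?X \<in> IScPp (M2, T)" by (rule M.dual_D_IScPp[OF A])
  have FX: "F2T ?X \<in> IScPp (N2, TN)" by (rule F2T_IScPp[OF X])
  have Y: "?Y \<in> IScPp (N2, TN)" by (rule N.dual_D_IScPp[OF FA])
  note Xd = IScPp_D[OF X M.Q] and FXd = IScPp_D[OF FX N.Q] and Yd = IScPp_D[OF Y N.Q]
  let ?U = "\<Phi> A ` homs A M1"
  have Fs: "is_struct (F2 (fst ?X))" using FXd(1) by simp
  have img: "?U = homs (F1 A) N1"
  proof (rule N.closed_separating_eq_homs[OF _ _ _ FA \<Phi>_image[OF A]])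
    show "fully_dualises TYPE('u) (N2, TN) N1" "fully_dualises TYPE('u \<Rightarrow> 'n) (N2, TN) N1"
      "injective_IScPp TYPE('u \<Rightarrow> 'n) (N2, TN)"
      using full by (simp_all add: fully_dualises_inj_def)
    show "subuniverse ?U (power_struct N2 (carr (F1 A)))"
      using iso_struct_image(1)[OF Fs \<Phi>_power[OF A]] by simp
    \<comment> \<open>The dual of \<open>A\<close> is compact, so its continuous image is compact
      and hence closed in the Hausdorff power of \<open>N2\<close>.\<close>
    have "compactin (subtopology (tpower (carr A) T) (homs A M1)) (homs A M1)"
      using Xd(2,3) by (simp add: compact_space_def)
    from image_compactin[OF this \<Phi>_cont[OF A]]
    show "closedin (tpower (carr (F1 A)) TN) ?U"
      using compactin_imp_closedin[OF tpower_topological(3)[OF N.Q]] by simp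
    show "separates_struct ?U (F1 A) N1"
      using separates_\<omega>_homs[OF A] by (simp add: \<Phi>_def)
  qed
  have hs: "homs (F1 A) N1 \<subseteq> carr (power_struct N2 (carr A))"
    using N.subuniverse_homs[OF FAd(1,3)] by (simp add: subuniverse_def)
  have "\<Phi> A \<in> homs (F2 (fst ?X)) (substruct (power_struct N2 (carr A)) (homs (F1 A) N1))"
    unfolding homs_substruct_iff[OF Fs hs] using \<Phi>_power(1)[OF A] img by simp
  moreover have "continuous_map (snd ?X) (snd ?Y) (\<Phi> A)"
    using \<Phi>_cont[OF A] img Xd(2) by (simp add: continuous_map_in_subtopology) blast
  moreover have "separates_struct {\<Phi> A} (F2 (fst ?X)) (substruct (power_struct N2 (carr A)) (homs (F1 A) N1))"
    by (rule separates_struct_codom[OF \<Phi>_power(2)[OF A]]) simp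
  ultimately have "iso_tstruct (F2T ?X) ?Y (\<Phi> A)"
    unfolding iso_tstruct_iff[OF FXd(1-3) Yd(1,2,7)] using img by (simp add: chom_iff)
  then show ?thesis using FX Y by (simp add: iso_in_IScPp_def)
qed

lemma \<Psi>_iso:
  fixes X :: "('u, 'f2, 'r2) tstruct"
  assumes full: "fully_dualises_inj TYPE('u) (N2, TN) N1" "fully_dualises_inj TYPE('u \<Rightarrow> 'n) (N2, TN) N1"
    and X: "X \<in> IScPp (M2, T)"
  shows "iso_in_ISP N1 (F1 (dual_E M1 (M2, T) X)) (dual_E N1 (N2, TN) (F2T X)) (\<Psi> X)"
proof -
  note Xd = IScPp_D[OF X M.Q] and FX = F2T_IScPp[OF X]
  note FXd = IScPp_D[OF FX N.Q]
  let ?A = "dual_E M1 (M2, T) X" and ?B = "dual_E N1 (N2, TN) (F2T X)"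
  have A: "?A \<in> ISP M1" by (rule M.dual_E_ISP[OF X])
  have FA: "F1 ?A \<in> ISP N1" by (rule F1_ISP[OF A])
  have B: "?B \<in> ISP N1" by (rule N.dual_E_ISP[OF FX])
  note FAd = ISP_D[OF FA N.is_struct_P] and Bd = ISP_D[OF B N.is_struct_P]
  have cA: "carr (F1 ?A) = chom X (M2, T)" by (simp add: M.dual_E_eq)
  let ?V = "\<Psi> X ` chom X (M2, T)"
  have img: "?V = chom (F2T X) (N2, TN)"
  proof (rule N.separating_eq_chom[OF _ _ _ FX \<Psi>_image[OF X]])
    show "fully_dualises TYPE('u) (N2, TN) N1" "fully_dualises TYPE('u \<Rightarrow> 'n) (N2, TN) N1"
      "injective_ISP TYPE('u \<Rightarrow> 'n) N1"
      using full by (simp_all add: fully_dualises_inj_def)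
    show "?V \<noteq> {}" using Xd(4) by simp
    show "subuniverse ?V (power_struct N1 (carr (fst (F2T X))))"
      using iso_struct_image(1)[OF FAd(1) \<Psi>_power[OF X]] by (simp add: cA[simplified])
    show "separates_struct ?V (fst (F2T X)) N2"
      using separates_\<omega>_chom[OF X] by (simp add: \<Psi>_def)
  qed
  have cs: "chom (F2T X) (N2, TN) \<subseteq> carr (power_struct N1 (carr (fst X)))"
    using N.subuniverse_chom[OF FXd(1,2,6)] by (simp add: subuniverse_def)
  have Beq: "?B = substruct (power_struct N1 (carr (fst X))) (chom (F2T X) (N2, TN))"
    by (simp add: N.dual_E_eq)
  have "\<Psi> X \<in> homs (F1 ?A) ?B"
    unfolding Beq homs_substruct_iff[OF FAd(1) cs] cA using \<Psi>_power(1)[OF X] img by simp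
  moreover have "separates_struct {\<Psi> X} (F1 ?A) ?B"
    unfolding Beq by (rule separates_struct_codom[OF \<Psi>_power(2)[OF X]]) simp
  ultimately have "iso_struct (F1 ?A) ?B (\<Psi> X)"
    unfolding iso_struct_iff[OF FAd(1) Bd(1)] cA using img by (simp add: Beq)
  then show ?thesis using FA B by (simp add: iso_in_ISP_def)
qed

section \<open>Full duality and injectivity carried over to \<open>M1\<close> and
  \<open>M2\<close>\<close>

lemma fully_dualises_transfer:
  assumes full: "fully_dualises_inj TYPE('u) (N2, TN) N1" "fully_dualises_inj TYPE('u \<Rightarrow> 'n) (N2, TN) N1"
  shows "fully_dualises TYPE('u) (M2, T) M1"
  unfolding M.fully_dualises_iff
proof (intro conjI allI impI subsetI)
  have fd: "fully_dualises TYPE('u) (N2, TN) N1" using full by (simp add: fully_dualises_inj_def)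
  fix A :: "('u, 'f1, 'r1) struct" and \<alpha> assume A: "A \<in> ISP M1" and \<alpha>: "\<alpha> \<in> chom (dual_D M1 (M2, T) A) (M2, T)"
  let ?X = "dual_D M1 (M2, T) A" and ?Y = "dual_D N1 (N2, TN) (F1 A)" and ?H = "homs A M1"
  have X: "?X \<in> IScPp (M2, T)" by (rule M.dual_D_IScPp[OF A])
  note Xd = IScPp_D[OF X M.Q] and FXd = IScPp_D[OF F2T_IScPp[OF X] N.Q]
    and Yd = IScPp_D[OF N.dual_D_IScPp[OF F1_ISP[OF A]] N.Q]
  have iso: "iso_tstruct (F2T ?X) ?Y (\<Phi> A)" using \<Phi>_iso[OF full A] by (simp add: iso_in_IScPp_def)
  obtain q where q: "q \<in> chom ?Y (F2T ?X)" "\<forall>x\<in>?H. q (\<Phi> A x) = x"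
    using iso_tstruct_inverse[OF iso FXd(2) Yd(2)] by auto
  have "compose (carr (fst ?X)) \<omega> \<alpha> \<in> chom (F2T ?X) (N2, TN)" by (rule \<omega>_chom[OF Xd(1,2,6) \<alpha>])
  \<comment> \<open>Moved along the inverse of \<open>\<Phi> A\<close>, the map \<omega> \<circ>
    \<alpha> lives on the dual of the reduct of \<open>A\<close>, where duality for
    \<open>N1\<close> makes it the evaluation at some \<open>a\<close>.\<close>
  from chom_comp[OF Yd(1,2) q(1) this]
  obtain a where a: "a \<in> carr A"
    "compose (homs (F1 A) N1) (compose ?H \<omega> \<alpha>) q = (\<lambda>x\<in>homs (F1 A) N1. x a)"
    using fd F1_ISP[OF A] unfolding N.fully_dualises_iff by fastforce
  let ?ev = "\<lambda>x\<in>?H. x a"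
  have "\<omega> (\<alpha> x) = \<omega> (?ev x)" if x: "x \<in> ?H" for x
  proof -
    have "\<Phi> A x \<in> homs (F1 A) N1" using \<Phi>_image[OF A] x by blast
    then show ?thesis
      using fun_cong[OF a(2), of "\<Phi> A x"] bspec[OF q(2) x] x a(1) by (simp add: compose_eq \<Phi>_def)
  qed
  then have "compose ?H \<omega> \<alpha> = compose ?H \<omega> ?ev" unfolding compose_def by (intro restrict_ext)
  moreover have ev: "?ev \<in> chom ?X (M2, T)" by (rule M.evaluation_chom[OF A a(1)])
  ultimately have "\<Psi> ?X \<alpha> = \<Psi> ?X ?ev" using \<alpha> by (simp add: \<Psi>_def)
  \<comment> \<open>\<omega> need not be injective on points; it cancels because
    \<open>\<Psi>\<close> is injective on the morphisms of the dual.\<close>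
  then have "\<alpha> = ?ev" using inj_onD[OF \<Psi>_inj[OF X] _ \<alpha> ev] by blast
  then show "\<alpha> \<in> (\<lambda>a. \<lambda>x\<in>homs A M1. x a) ` carr A" using a(1) by blast
next
  have fd: "fully_dualises TYPE('u) (N2, TN) N1" using full by (simp add: fully_dualises_inj_def)
  fix X :: "('u, 'f2, 'r2) tstruct" and h assume X: "X \<in> IScPp (M2, T)" and h: "h \<in> homs (dual_E M1 (M2, T) X) M1"
  let ?A = "dual_E M1 (M2, T) X" and ?B = "dual_E N1 (N2, TN) (F2T X)" and ?H = "chom X (M2, T)"
  have A: "?A \<in> ISP M1" by (rule M.dual_E_ISP[OF X])
  note Ad = ISP_D[OF A M.is_struct_P] and Bd = ISP_D[OF N.dual_E_ISP[OF F2T_IScPp[OF X]] N.is_struct_P]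
  have cA: "carr ?A = ?H" and cB: "carr ?B = chom (F2T X) (N2, TN)" by (simp_all add: M.dual_E_eq N.dual_E_eq)
  have iso: "iso_struct (F1 ?A) ?B (\<Psi> X)" using \<Psi>_iso[OF full X] by (simp add: iso_in_ISP_def)
  obtain q where q: "q \<in> homs ?B (F1 ?A)" "\<forall>\<alpha>\<in>?H. q (\<Psi> X \<alpha>) = \<alpha>"
    using iso_struct_inverse[OF iso] by (auto simp: M.dual_E_eq)
  have "compose ?H \<omega> h \<in> homs (F1 ?A) N1" using \<omega>_homs[OF Ad(1,3) h] by (simp add: cA)
  from homs_comp[OF Bd(1) q(1) this]
  obtain x where x: "x \<in> carr (fst X)"
    "compose (chom (F2T X) (N2, TN)) (compose ?H \<omega> h) q = (\<lambda>\<alpha>\<in>chom (F2T X) (N2, TN). \<alpha> x)"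
    using fd F2T_IScPp[OF X] unfolding N.fully_dualises_iff cB by fastforce
  let ?ev = "\<lambda>\<alpha>\<in>?H. \<alpha> x"
  have "\<omega> (h \<alpha>) = \<omega> (?ev \<alpha>)" if \<alpha>: "\<alpha> \<in> ?H" for \<alpha>
  proof -
    have "\<Psi> X \<alpha> \<in> chom (F2T X) (N2, TN)" using \<Psi>_image[OF X] \<alpha> by blast
    then show ?thesis
      using fun_cong[OF x(2), of "\<Psi> X \<alpha>"] bspec[OF q(2) \<alpha>] \<alpha> x(1) by (simp add: compose_eq \<Psi>_def)
  qed
  then have "compose ?H \<omega> h = compose ?H \<omega> ?ev" unfolding compose_def by (intro restrict_ext)
  moreover have ev: "?ev \<in> homs ?A M1" by (rule M.evaluation_homs[OF X x(1)])
  \<comment> \<open>Here \<open>\<Phi>\<close> at the algebra \<open>?A\<close> cancels \<omega>,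
    just as \<open>\<Psi>\<close> did on the dual of \<open>A\<close>.\<close>
  ultimately have "\<Phi> ?A h = \<Phi> ?A ?ev" using h by (simp add: \<Phi>_def cA)
  then have "h = ?ev" using inj_onD[OF \<Phi>_inj[OF A] _ h ev] by blast
  then show "h \<in> (\<lambda>x. \<lambda>\<alpha>\<in>chom X (M2, T). \<alpha> x) ` carr (fst X)" using x(1) by blast
qed

text \<open>Extend \<omega> \<circ> f by injectivity of \<open>N1\<close>, lift the extension
  through the surjection \<open>\<Phi> B\<close>, and cancel \<omega> by injectivity of
  \<open>\<Phi> A\<close>.\<close>

lemma injective_ISP_transfer:
  assumes full: "fully_dualises_inj TYPE('u) (N2, TN) N1" "fully_dualises_inj TYPE('u \<Rightarrow> 'n) (N2, TN) N1"
  shows "injective_ISP TYPE('u) M1"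
  unfolding injective_ISP_def
proof (intro ballI allI impI)
  fix A B :: "('u, 'f1, 'r1) struct" and i f
  assume A: "A \<in> ISP M1" and B: "B \<in> ISP M1" and if': "embedding A B i \<and> f \<in> homs A M1"
  note Ad = ISP_D[OF A M.is_struct_P] and Bd = ISP_D[OF B M.is_struct_P] and FA = F1_ISP[OF A] and FB = F1_ISP[OF B]
  have i: "i \<in> homs A B" "separates_struct {i} A B" and f: "f \<in> homs A M1"
    using if' embedding_iff[OF Ad(1)] by blast+
  have \<rho>: "reduct_scheme (sg A) (sg N1) \<rho>1" using scheme1 Ad(3) by simp
  \<comment> \<open>An embedding reflects atomic formulas, so it remains an embedding between the
    reducts.\<close>
  have emb: "embedding (F1 A) (F1 B) i"
    using embedding_iff[OF ISP_D(1)[OF FA N.is_struct_P], of "F1 B" i] homs_flat[OF Ad(1) \<rho> i(1)]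
      separates_struct_flat[OF Ad(1) \<rho> _ i(2)] i(1) Ad(2) by simp
  have inj: "injective_ISP TYPE('u) N1" using full by (simp add: fully_dualises_inj_def)
  obtain g' where g': "g' \<in> homs (F1 B) N1" "compose (carr (F1 A)) g' i = compose (carr A) \<omega> f"
    using inj FA FB emb \<omega>_homs[OF Ad(1,3) f] unfolding injective_ISP_def by metis
  have "iso_tstruct (F2T (dual_D M1 (M2, T) B)) (dual_D N1 (N2, TN) (F1 B)) (\<Phi> B)"
    using \<Phi>_iso[OF full B] by (simp add: iso_in_IScPp_def)
  then have "\<Phi> B ` homs B M1 = homs (F1 B) N1"
    by (simp add: iso_tstruct_def iso_struct_def bij_betw_def)
  then obtain g where g: "g \<in> homs B M1" "g' = compose (carr B) \<omega> g"
    using g'(1) by (auto simp: \<Phi>_def)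
  have gi: "compose (carr A) g i \<in> homs A M1" by (rule homs_comp[OF Ad(1) i(1) g(1)])
  have "compose (carr A) \<omega> (compose (carr A) g i) = compose (carr A) g' i"
    unfolding g(2) compose_def using homs_Pi[OF i(1)] by (intro restrict_ext) auto
  then have "\<Phi> A (compose (carr A) g i) = \<Phi> A f" using g'(2) gi f by (simp add: \<Phi>_def)
  then have "compose (carr A) g i = f" using inj_onD[OF \<Phi>_inj[OF A] _ gi f] by blast
  then show "\<exists>g\<in>homs B M1. compose (carr A) g i = f" using g(1) by blast
qed

text \<open>The same lifting with \<open>\<Psi>\<close>: its surjectivity at \<open>Y\<close> lifts
  the extension, its injectivity at \<open>X\<close> cancels \<omega>.\<close>

lemma injective_IScPp_transfer:
  assumes full: "fully_dualises_inj TYPE('u) (N2, TN) N1" "fully_dualises_inj TYPE('u \<Rightarrow> 'n) (N2, TN) N1"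
  shows "injective_IScPp TYPE('u) (M2, T)"
  unfolding injective_IScPp_def
proof (intro ballI allI impI)
  fix X Y :: "('u, 'f2, 'r2) tstruct" and i f
  assume X: "X \<in> IScPp (M2, T)" and Y: "Y \<in> IScPp (M2, T)" and if': "tembedding X Y i \<and> f \<in> chom X (M2, T)"
  note Xd = IScPp_D[OF X M.Q] and Yd = IScPp_D[OF Y M.Q] and FX = F2T_IScPp[OF X] and FY = F2T_IScPp[OF Y]
  note FXd = IScPp_D[OF FX N.Q] and FYd = IScPp_D[OF FY N.Q]
  have i: "i \<in> chom X Y" "separates_struct {i} (fst X) (fst Y)" and f: "f \<in> chom X (M2, T)"
    using if' tembedding_iff[OF Xd(1-3) Yd(1,2,7)] by blast+
  have ih: "i \<in> homs (fst X) (fst Y)" using i(1) by (simp add: chom_iff)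
  have \<rho>: "reduct_scheme (sg (fst X)) (sg N2) \<rho>2" using scheme2 Xd(6) by simp
  have emb: "tembedding (F2T X) (F2T Y) i"
    unfolding tembedding_iff[OF FXd(1-3) FYd(1,2,7)]
    using homs_flat[OF Xd(1) \<rho> ih] separates_struct_flat[OF Xd(1) \<rho> _ i(2)] ih i(1) by (simp add: chom_iff)
  have inj: "injective_IScPp TYPE('u) (N2, TN)" using full by (simp add: fully_dualises_inj_def)
  obtain g' where g': "g' \<in> chom (F2T Y) (N2, TN)"
      "compose (carr (fst (F2T X))) g' i = compose (carr (fst X)) \<omega> f"
    using inj FX FY emb \<omega>_chom[OF Xd(1,2,6) f] unfolding injective_IScPp_def by metis
  have "iso_struct (F1 (dual_E M1 (M2, T) Y)) (dual_E N1 (N2, TN) (F2T Y)) (\<Psi> Y)"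
    using \<Psi>_iso[OF full Y] by (simp add: iso_in_ISP_def)
  then have "\<Psi> Y ` chom Y (M2, T) = chom (F2T Y) (N2, TN)"
    by (simp add: iso_struct_def bij_betw_def M.dual_E_eq N.dual_E_eq)
  then obtain g where g: "g \<in> chom Y (M2, T)" "g' = compose (carr (fst Y)) \<omega> g"
    using g'(1) by (auto simp: \<Psi>_def)
  have gi: "compose (carr (fst X)) g i \<in> chom X (M2, T)" by (rule chom_comp[OF Xd(1,2) i(1) g(1)])
  have "compose (carr (fst X)) \<omega> (compose (carr (fst X)) g i) = compose (carr (fst X)) g' i"
    unfolding g(2) compose_def using homs_Pi[OF ih] by (intro restrict_ext) auto
  then have "\<Psi> X (compose (carr (fst X)) g i) = \<Psi> X f" using g'(2) gi f by (simp add: \<Psi>_def)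
  then have "compose (carr (fst X)) g i = f" using inj_onD[OF \<Psi>_inj[OF X] _ gi f] by blast
  then show "\<exists>g\<in>chom Y (M2, T). compose (carr (fst X)) g i = f" using g(1) by blast
qed

lemma fully_dualises_inj_transfer:
  assumes "fully_dualises_inj TYPE('u) (N2, TN) N1" "fully_dualises_inj TYPE('u \<Rightarrow> 'n) (N2, TN) N1"
  shows "fully_dualises_inj TYPE('u) (M2, T) M1"
  unfolding fully_dualises_inj_def
  using fully_dualises_transfer[OF assms] injective_ISP_transfer[OF assms] injective_IScPp_transfer[OF assms] by blast

end

section \<open>From the conditions (I) and (II) to both dualities\<close>

lemma separates_points_algebra:
  "separates_points Z (carr A) \<Longrightarrow> relsyms (sg A) = {} \<Longrightarrow> separates_struct Z A N"
  by (simp add: separates_struct_def)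

theorem theorem3p8:
  fixes M1 :: "('m, 'f1, 'r1) struct" and M2 :: "('m, 'f2, 'r2) struct" and T :: "'m topology"
    and N1 :: "('n, 'g1, 'q1) struct" and N2 :: "('n, 'g2, 'q2) struct" and TN :: "'n topology"
    and \<rho>1 :: "('f1, 'r1, 'g1, 'q1) scheme" and \<rho>2 :: "('f2, 'r2, 'g2, 'q2) scheme"
    and \<omega> :: "'m \<Rightarrow> 'n"
  defines "M1T \<equiv> (M1, T)" and "M2T \<equiv> (M2, T)" and "N1T \<equiv> (N1, TN)" and "N2T \<equiv> (N2, TN)"
  assumes "topological_struct M1 T" and "topological_struct M2 T"
    and "topological_struct N1 TN" and "topological_struct N2 TN"
    and "alter_ego M2T M1" and "alter_ego N2T N1"
    (* the hypothesis on N1 and N2 concerns all members of the four classes; it is used for those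
       with carriers in 'u, 'u \<Rightarrow> 'm and 'u \<Rightarrow> 'n to conclude for those with carriers in 'u *)
    and "fully_dualises_inj TYPE('u) N1T N2" and "fully_dualises_inj TYPE('u) N2T N1"
    and "fully_dualises_inj TYPE('u \<Rightarrow> 'm) N1T N2" and "fully_dualises_inj TYPE('u \<Rightarrow> 'm) N2T N1"
    and "fully_dualises_inj TYPE('u \<Rightarrow> 'n) N1T N2" and "fully_dualises_inj TYPE('u \<Rightarrow> 'n) N2T N1"
    and "reduct_scheme (sg M1) (sg N1) \<rho>1" and "reduct_scheme (sg M2) (sg N2) \<rho>2"
    and "tflat (sg N1) \<rho>1 M1T \<in> IScPp N1T" and "tflat (sg N2) \<rho>2 M2T \<in> IScPp N2T"
    and "continuous_map T TN \<omega>"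
    and "\<omega> \<in> homs (flat (sg N1) \<rho>1 M1) N1 \<inter> homs (flat (sg N2) \<rho>2 M2) N2"
    and "(total_algebra N1 \<and>
          separates_points (comp_set (carr M1) \<omega> (Clo1 M2)) (carr M1) \<and>
          separates_struct (comp_set (carr M1) \<omega> (Clo1 M1)) (flat (sg N2) \<rho>2 M2) N2 \<and>
          (\<forall>r\<in>relsyms (sg N2). \<forall>s\<in>max_rels M1 \<omega> (rar N2 r) (rln N2 r).
             alg_entails TYPE('u) M1T M2 (rar N2 r) s \<and> top_entails TYPE('u) M1 M2T (rar N2 r) s))
         \<or>
         (total_algebra N1 \<and> total_algebra N2 \<and>
          separates_points (comp_set (carr M1) \<omega> (Clo1 M2)) (carr M1) \<and>
          separates_points (comp_set (carr M1) \<omega> (Clo1 M1)) (carr M1))"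
  shows "fully_dualises_inj TYPE('u) M2T M1 \<and>
         fully_dualises_inj TYPE('u) M1T M2 \<and>
         (\<forall>(A :: ('u, 'f1, 'r1) struct) \<in> ISP M1.
            iso_in_IScPp N2T
              (tflat (sg N2) \<rho>2 (dual_D M1 M2T A)) (dual_D N1 N2T (flat (sg N1) \<rho>1 A))
              (\<lambda>x\<in>homs A M1. compose (carr A) \<omega> x)) \<and>
         (\<forall>(X :: ('u, 'f2, 'r2) tstruct) \<in> IScPp M2T.
            iso_in_ISP N1
              (flat (sg N1) \<rho>1 (dual_E M1 M2T X)) (dual_E N1 N2T (tflat (sg N2) \<rho>2 X))
              (\<lambda>\<alpha>\<in>chom X M2T. compose (carr (fst X)) \<omega> \<alpha>)) \<and>
         (\<forall>(A :: ('u, 'f2, 'r2) struct) \<in> ISP M2.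
            iso_in_IScPp N1T
              (tflat (sg N1) \<rho>1 (dual_D M2 M1T A)) (dual_D N2 N1T (flat (sg N2) \<rho>2 A))
              (\<lambda>x\<in>homs A M2. compose (carr A) \<omega> x)) \<and>
         (\<forall>(X :: ('u, 'f1, 'r1) tstruct) \<in> IScPp M1T.
            iso_in_ISP N2
              (flat (sg N2) \<rho>2 (dual_E M2 M1T X)) (dual_E N2 N1T (tflat (sg N1) \<rho>1 X))
              (\<lambda>\<alpha>\<in>chom X M1T. compose (carr (fst X)) \<omega> \<alpha>))"
proof -
  note defs = M1T_def M2T_def N1T_def N2T_def
  have carr: "carr M2 = carr M1" using assms(9) by (simp add: alter_ego_def defs)
  \<comment> \<open>\<open>N1\<close> is an algebra in both cases, so the reduct of
    \<open>M1\<close> has no relations and separating its points is enough.\<close>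
  have sep1: "separates_struct (comp_set (carr M1) \<omega> (Clo1 M2)) (flat (sg N1) \<rho>1 M1) N1"
    using assms(23) by (intro separates_points_algebra) (auto simp: total_algebra_def)
  \<comment> \<open>Assumed outright in (I); in (II) the reduct of \<open>M2\<close> has no
    relations either.\<close>
  have sep2: "separates_struct (comp_set (carr M1) \<omega> (Clo1 M1)) (flat (sg N2) \<rho>2 M2) N2"
    using assms(23)
  proof (elim disjE conjE)
    assume "total_algebra N2" "separates_points (comp_set (carr M1) \<omega> (Clo1 M1)) (carr M1)"
    then show ?thesis by (intro separates_points_algebra) (simp_all add: total_algebra_def carr)
  qed
  interpret transfer M1 M2 T N1 N2 TN \<rho>1 \<rho>2 \<omega>
    using assms(5-10,17,18,21,22) sep1 sep2
    by (intro transfer.intro dual_pair.intro transfer_axioms.intro) (simp_all add: defs)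
  interpret sw: transfer M2 M1 T N2 N1 TN \<rho>2 \<rho>1 \<omega> by (rule swap)
  \<comment> \<open>The type \<open>'u \<Rightarrow> 'n\<close> is that of the elements of the
    duals, over \<open>N1\<close> and \<open>N2\<close>, of reducts with carrier in
    \<open>'u\<close>.\<close>
  have full2: "fully_dualises_inj TYPE('u) (N2, TN) N1" "fully_dualises_inj TYPE('u \<Rightarrow> 'n) (N2, TN) N1"
    using assms(12,16) by (simp_all add: defs)
  have full1: "fully_dualises_inj TYPE('u) (N1, TN) N2" "fully_dualises_inj TYPE('u \<Rightarrow> 'n) (N1, TN) N2"
    using assms(11,15) by (simp_all add: defs)
  show ?thesis
    unfolding defs
    using fully_dualises_inj_transfer[OF full2] sw.fully_dualises_inj_transfer[OF full1]
      \<Phi>_iso[OF full2] \<Psi>_iso[OF full2] sw.\<Phi>_iso[OF full1] sw.\<Psi>_iso[OF full1]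
    unfolding \<Phi>_def \<Psi>_def sw.\<Phi>_def sw.\<Psi>_def by blast
qed

end
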